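(* The rotationally symmetric map $\varphi:(S^2,dr^2+\sin^2r\,d\theta^2)\longrightarrow(S^2,d\rho^2+\sin^2\rho\,d\phi^2)$ with $\varphi(r,\theta)=(r,\sqrt3\,\theta)$ is an $f$-biharmonic map for $$f(r,\theta)=\left|\frac{(\tan\frac r2)^{1+\sqrt3}\left(\tan^2\frac r2+7+4\sqrt3\right)\left(\tan^2\frac r2-2-\sqrt3\right)}{\left(1+\tan^2\frac r2\right)^2\left(\tan^2\frac r2-1\right)}\right| ,$$ which is smooth on $(0,\pi)$ except at $r=\frac\pi2$ and $r=2\arctan\sqrt{2+\sqrt3}$.
   Context: For a smooth map $\phi:(M,g)\to(N,h)$ of Riemannian manifolds, $\tau(\phi)=\mathrm{Tr}_g\nabla d\phi$ is the tension field and $\tau_2(\phi)=\mathrm{Trace}_g(\nabla^\phi\nabla^\phi-\nabla^\phi_{\nabla^M})\tau(\phi)-\mathrm{Trace}_g R^N(d\phi,\tau(\phi))d\phi$ is the bitension field, with $R^N(X,Y)Z=[\nabla^N_X,\nabla^N_Y]Z-\nabla^N_{[X,Y]}Z$. For a positive function $f$ on $M$, the map is $f$-biharmonic if $f\tau_2(\phi)+(\Delta f)\tau(\phi)+2\nabla^\phi_{\mathrm{grad} f}\tau(\phi)=0$. On the standard 2-sphere, $(r,\theta)$ (resp. $(\rho,\phi)$ on the target) are geodesic polar coordinates, with $0<r<\pi$ and $\theta$ the angular coordinate. As an $f$-biharmonic map, the map is allowed to have singular points. *)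

theory Defs
  imports "HOL-Analysis.Analysis"
begin

section \<open>Smoothness\<close>

text \<open>On an open set S this says that all iterated directional derivatives up to order n
  exist and are continuous.\<close>

primrec Ck_on :: "nat \<Rightarrow> 'a::euclidean_space set \<Rightarrow> ('a \<Rightarrow> 'b::real_normed_vector) \<Rightarrow> bool" where
  "Ck_on 0 S F \<longleftrightarrow> continuous_on S F"
| "Ck_on (Suc n) S F \<longleftrightarrow>
     (\<forall>x\<in>S. F differentiable (at x)) \<and> (\<forall>v. Ck_on n S (\<lambda>x. frechet_derivative F (at x) v))"

definition smooth_on :: "'a::euclidean_space set \<Rightarrow> ('a \<Rightarrow> 'b::real_normed_vector) \<Rightarrow> bool" where
  "smooth_on S F \<longleftrightarrow> open S \<and> (\<forall>n. Ck_on n S F)"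

definition smooth_at :: "('a::euclidean_space \<Rightarrow> 'b::real_normed_vector) \<Rightarrow> 'a \<Rightarrow> bool" where
  "smooth_at F x \<longleftrightarrow> (\<exists>S. x \<in> S \<and> smooth_on S F)"


section \<open>Riemannian geometry in a coordinate domain\<close>

text \<open>The points of a coordinate domain are elements of \<open>real^'n\<close>. A metric is the matrix of
  its coefficients with respect to the coordinate frame, and a vector field, or a section of the
  pullback of the tangent bundle along a map, is the tuple of its components in the coordinate
  frame (of the source or of the target, respectively).\<close>

type_synonym 'n metric = "real^'n \<Rightarrow> real^'n^'n"
type_synonym 'n vfield = "real^'n \<Rightarrow> real^'n"

definition riemannian_metric_on :: "(real^'n::finite) set \<Rightarrow> 'n metric \<Rightarrow> bool" where
  "riemannian_metric_on U g \<longleftrightarrow> smooth_on U g \<and>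
     (\<forall>x\<in>U. transpose (g x) = g x \<and> (\<forall>v. v \<noteq> 0 \<longrightarrow> v \<bullet> (g x *v v) > 0))"

definition coord_field :: "'n::finite \<Rightarrow> 'n vfield" where
  "coord_field i = (\<lambda>x. axis i 1)"

definition dir_deriv :: "'n::finite vfield \<Rightarrow> (real^'n \<Rightarrow> 'b::real_normed_vector) \<Rightarrow> real^'n \<Rightarrow> 'b" where
  "dir_deriv X F = (\<lambda>x. frechet_derivative F (at x) (X x))"

definition christoffel :: "'n::finite metric \<Rightarrow> 'n \<Rightarrow> 'n \<Rightarrow> 'n \<Rightarrow> real^'n \<Rightarrow> real" where
  "christoffel g k i j x =
     (\<Sum>l\<in>UNIV. matrix_inv (g x) $ k $ l *
        (dir_deriv (coord_field i) (\<lambda>y. g y $ j $ l) x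
         + dir_deriv (coord_field j) (\<lambda>y. g y $ i $ l) x
         - dir_deriv (coord_field l) (\<lambda>y. g y $ i $ j) x)) / 2"

definition levi_civita :: "'n::finite metric \<Rightarrow> 'n vfield \<Rightarrow> 'n vfield \<Rightarrow> 'n vfield" where
  "levi_civita g X Y = (\<lambda>x. dir_deriv X Y x +
     (\<chi> k. \<Sum>i\<in>UNIV. \<Sum>j\<in>UNIV. christoffel g k i j x * X x $ i * Y x $ j))"

definition lie_bracket :: "'n::finite vfield \<Rightarrow> 'n vfield \<Rightarrow> 'n vfield" where
  "lie_bracket X Y = (\<lambda>x. dir_deriv X Y x - dir_deriv Y X x)"

definition curvature :: "'n::finite metric \<Rightarrow> 'n vfield \<Rightarrow> 'n vfield \<Rightarrow> 'n vfield \<Rightarrow> 'n vfield" where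
  "curvature g X Y Z = (\<lambda>x.
     levi_civita g X (levi_civita g Y Z) x
     - levi_civita g Y (levi_civita g X Z) x
     - levi_civita g (lie_bracket X Y) Z x)"

text \<open>Curvature is tensorial, so its value on tangent vectors u, v, w at a point p is obtained by
  extending them to vector fields with constant components.\<close>

definition curvature_at ::
    "'n::finite metric \<Rightarrow> real^'n \<Rightarrow> real^'n \<Rightarrow> real^'n \<Rightarrow> real^'n \<Rightarrow> real^'n" where
  "curvature_at g p u v w = curvature g (\<lambda>_. u) (\<lambda>_. v) (\<lambda>_. w) p"

text \<open>Trace over the source metric of a form given on vector fields, computed in the coordinate
  frame; it is applied only to forms that are tensorial in both arguments.\<close>

definition metric_trace ::
    "'n::finite metric \<Rightarrow> ('n vfield \<Rightarrow> 'n vfield \<Rightarrow> real^'n \<Rightarrow> 'b::real_normed_vector)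
      \<Rightarrow> real^'n \<Rightarrow> 'b" where
  "metric_trace g B = (\<lambda>x. \<Sum>i\<in>UNIV. \<Sum>j\<in>UNIV.
     (matrix_inv (g x) $ i $ j) *\<^sub>R B (coord_field i) (coord_field j) x)"

definition gradient :: "'n::finite metric \<Rightarrow> (real^'n \<Rightarrow> real) \<Rightarrow> 'n vfield" where
  "gradient g f = (\<lambda>x. matrix_inv (g x) *v (\<chi> i. dir_deriv (coord_field i) f x))"

definition hessian ::
    "'n::finite metric \<Rightarrow> (real^'n \<Rightarrow> real) \<Rightarrow> 'n vfield \<Rightarrow> 'n vfield \<Rightarrow> real^'n \<Rightarrow> real" where
  "hessian g f X Y = (\<lambda>x. dir_deriv X (dir_deriv Y f) x - dir_deriv (levi_civita g X Y) f x)"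

text \<open>Sign convention: the Laplacian is the divergence of the gradient.\<close>

definition laplacian :: "'n::finite metric \<Rightarrow> (real^'n \<Rightarrow> real) \<Rightarrow> real^'n \<Rightarrow> real" where
  "laplacian g f = metric_trace g (hessian g f)"


section \<open>Tension, bitension and f-biharmonic maps\<close>

definition pullback_conn ::
    "'m::finite metric \<Rightarrow> (real^'n::finite \<Rightarrow> real^'m) \<Rightarrow> 'n vfield \<Rightarrow> (real^'n \<Rightarrow> real^'m)
      \<Rightarrow> real^'n \<Rightarrow> real^'m" where
  "pullback_conn h \<phi> X V = (\<lambda>x. dir_deriv X V x +
     (\<chi> c. \<Sum>a\<in>UNIV. \<Sum>b\<in>UNIV. christoffel h c a b (\<phi> x) * dir_deriv X \<phi> x $ a * V x $ b))"

text \<open>Note that \<open>dir_deriv X \<phi>\<close> is the section obtained by applying the differential of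
  \<open>\<phi>\<close> to X.\<close>

definition second_fundamental_form ::
    "'n::finite metric \<Rightarrow> 'm::finite metric \<Rightarrow> (real^'n \<Rightarrow> real^'m)
      \<Rightarrow> 'n vfield \<Rightarrow> 'n vfield \<Rightarrow> real^'n \<Rightarrow> real^'m" where
  "second_fundamental_form g h \<phi> X Y = (\<lambda>x.
     pullback_conn h \<phi> X (dir_deriv Y \<phi>) x - dir_deriv (levi_civita g X Y) \<phi> x)"

definition tension ::
    "'n::finite metric \<Rightarrow> 'm::finite metric \<Rightarrow> (real^'n \<Rightarrow> real^'m) \<Rightarrow> real^'n \<Rightarrow> real^'m" where
  "tension g h \<phi> = metric_trace g (second_fundamental_form g h \<phi>)"

definition rough_laplacian ::
    "'n::finite metric \<Rightarrow> 'm::finite metric \<Rightarrow> (real^'n \<Rightarrow> real^'m) \<Rightarrow> (real^'n \<Rightarrow> real^'m)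
      \<Rightarrow> real^'n \<Rightarrow> real^'m" where
  "rough_laplacian g h \<phi> V = metric_trace g (\<lambda>X Y x.
     pullback_conn h \<phi> X (pullback_conn h \<phi> Y V) x
     - pullback_conn h \<phi> (levi_civita g X Y) V x)"

definition bitension ::
    "'n::finite metric \<Rightarrow> 'm::finite metric \<Rightarrow> (real^'n \<Rightarrow> real^'m) \<Rightarrow> real^'n \<Rightarrow> real^'m" where
  "bitension g h \<phi> = (\<lambda>x.
     rough_laplacian g h \<phi> (tension g h \<phi>) x
     - metric_trace g (\<lambda>X Y x.
         curvature_at h (\<phi> x) (dir_deriv X \<phi> x) (tension g h \<phi> x) (dir_deriv Y \<phi> x)) x)"

definition f_biharmonic ::
    "(real^'n::finite) set \<Rightarrow> 'n metric \<Rightarrow> (real^'m::finite) set \<Rightarrow> 'm metric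
      \<Rightarrow> (real^'n \<Rightarrow> real) \<Rightarrow> (real^'n \<Rightarrow> real^'m) \<Rightarrow> bool" where
  "f_biharmonic U g V h f \<phi> \<longleftrightarrow>
     riemannian_metric_on U g \<and> riemannian_metric_on V h \<and>
     smooth_on U \<phi> \<and> \<phi> ` U \<subseteq> V \<and>
     smooth_on U f \<and> (\<forall>x\<in>U. f x > 0) \<and>
     (\<forall>x\<in>U. f x *\<^sub>R bitension g h \<phi> x
           + laplacian g f x *\<^sub>R tension g h \<phi> x
           + 2 *\<^sub>R pullback_conn h \<phi> (gradient g f) (tension g h \<phi>) x = 0)"


section \<open>The 2-sphere in geodesic polar coordinates\<close>

text \<open>Component 1 is the distance r from the pole and component 2 is the angle. The angle ranges
  over all of the real line, i.e. we work on the universal cover of the sphere without its two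
  poles: a map such as multiplying the angle by a non-integer is not single-valued on the sphere,
  and its branches over the sectors of width \<open>2 * pi\<close> are restrictions of the map on the
  strip.\<close>

definition polar_domain :: "(real^2) set" where
  "polar_domain = {x. 0 < x $ 1 \<and> x $ 1 < pi}"

definition sphere_metric :: "2 metric" where
  "sphere_metric x = vector [vector [1, 0], vector [0, (sin (x $ 1))\<^sup>2]]"

text \<open>The lemmas below justify the name: the polar parametrization maps the strip onto the unit
  sphere without its poles, two points of the strip have the same image exactly when their angles
  differ by a multiple of \<open>2 * pi\<close>, and the metric above is the one induced from Euclidean
  space.\<close>

definition polar_param :: "real^2 \<Rightarrow> real^3" where
  "polar_param x = vector [sin (x $ 1) * cos (x $ 2), sin (x $ 1) * sin (x $ 2), cos (x $ 1)]"

lemma polar_param_image: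
  "polar_param ` polar_domain = sphere 0 1 - {axis 3 1, axis 3 (-1)}"
proof (intro equalityI subsetI)
  fix p assume "p \<in> polar_param ` polar_domain"
  then obtain x where x: "0 < x $ 1" "x $ 1 < pi" and p: "p = polar_param x"
    by (auto simp: polar_domain_def)
  have "(norm p)\<^sup>2 = (sin (x$1))\<^sup>2 * ((cos (x$2))\<^sup>2 + (sin (x$2))\<^sup>2) + (cos (x$1))\<^sup>2"
    unfolding p polar_param_def power2_norm_eq_inner
    by (simp add: inner_vec_def sum_3 algebra_simps power2_eq_square
             del: sin_cos_squared_add sin_cos_squared_add2 sin_cos_squared_add3)
  then have "(norm p)\<^sup>2 = 1" by (simp only: sin_cos_squared_add2 sin_cos_squared_add mult_1_right)
  then have n: "norm p = 1" by (simp add: power2_eq_1_iff) (smt (verit) norm_ge_zero)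
  have "\<bar>p $ 3\<bar> \<noteq> 1"
  proof
    assume "\<bar>p $ 3\<bar> = 1"
    then have "(cos (x$1))\<^sup>2 = 1" by (auto simp: p polar_param_def abs_if split: if_splits)
    then have "sin (x$1) = 0" by (simp add: cos_squared_eq)
    then show False using sin_gt_zero[OF x] by simp
  qed
  then have "p \<noteq> axis 3 1" "p \<noteq> axis 3 (-1)" by (auto simp: axis_def)
  then show "p \<in> sphere 0 1 - {axis 3 1, axis 3 (-1)}" using n by simp
next
  fix p :: "real^3" assume p: "p \<in> sphere 0 1 - {axis 3 1, axis 3 (-1)}"
  then have "p \<bullet> p = 1" by (simp add: norm_eq_1)
  then have s: "(p$1)\<^sup>2 + (p$2)\<^sup>2 + (p$3)\<^sup>2 = 1"
    by (simp add: inner_vec_def sum_3 power2_eq_square)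
  have ne: "(p$1)\<^sup>2 + (p$2)\<^sup>2 \<noteq> 0"
  proof
    assume 0: "(p$1)\<^sup>2 + (p$2)\<^sup>2 = 0"
    then have "p$1 = 0" "p$2 = 0" by (simp_all add: sum_power2_eq_zero_iff)
    moreover have "p$3 = 1 \<or> p$3 = -1" using s 0 by (simp add: power2_eq_1_iff)
    ultimately have "p = axis 3 1 \<or> p = axis 3 (-1)"
      by (auto simp: vec_eq_iff forall_3 axis_def)
    then show False using p by auto
  qed
  then have pos: "(p$1)\<^sup>2 + (p$2)\<^sup>2 > 0" by (simp add: order.not_eq_order_implies_strict)
  then have "(p$3)\<^sup>2 < 1" using s by linarith
  then have b: "-1 < p$3" "p$3 < 1" by (simp_all add: abs_square_less_1 abs_less_iff)
  define r where "r = arccos (p$3)"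
  have r: "0 < r" "r < pi" "cos r = p$3" using b arccos_lt_bounded[of "p$3"]
    by (auto simp: r_def)
  have sr: "sin r > 0" using r by (simp add: sin_gt_zero)
  have s2: "(sin r)\<^sup>2 = (p$1)\<^sup>2 + (p$2)\<^sup>2" using s r by (simp add: sin_squared_eq)
  have "(p$1 / sin r)\<^sup>2 + (p$2 / sin r)\<^sup>2 = 1"
    using ne by (simp add: power_divide s2 add_divide_distrib[symmetric] del: sum_power2_eq_zero_iff)
  then obtain t where t: "p$1 / sin r = cos t" "p$2 / sin r = sin t"
    using sincos_total_2pi by metis
  have "p = polar_param (vector [r, t])"
    using t r sr by (simp add: vec_eq_iff forall_3 polar_param_def field_simps)
  moreover have "vector [r, t] \<in> polar_domain" using r by (simp add: polar_domain_def)
  ultimately show "p \<in> polar_param ` polar_domain" by blast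
qed

lemma polar_param_eq_iff:
  assumes "x \<in> polar_domain" "y \<in> polar_domain"
  shows "polar_param x = polar_param y \<longleftrightarrow> x $ 1 = y $ 1 \<and> (\<exists>k::int. x $ 2 = y $ 2 + 2 * pi * k)"
proof -
  have x: "0 < x $ 1" "x $ 1 < pi" and y: "0 < y $ 1" "y $ 1 < pi"
    using assms by (auto simp: polar_domain_def)
  have sx: "sin (x $ 1) > 0" using x by (rule sin_gt_zero)
  have c: "cos (x $ 1) = cos (y $ 1) \<longleftrightarrow> x $ 1 = y $ 1"
    using cos_inj_pi[of "x$1" "y$1"] x y by auto
  have "polar_param x = polar_param y \<longleftrightarrow>
      x $ 1 = y $ 1 \<and> sin (x $ 2) = sin (y $ 2) \<and> cos (x $ 2) = cos (y $ 2)"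
    using sx c by (auto simp: polar_param_def vec_eq_iff forall_3)
  then show ?thesis by (auto simp: sin_cos_eq_iff)
qed

lemma polar_param_induced_metric:
  "frechet_derivative polar_param (at x) (axis i 1)
     \<bullet> frechet_derivative polar_param (at x) (axis j 1) = sphere_metric x $ i $ j"
proof -
  define D where "D = (\<lambda>v::real^2. vector
     [cos (x$1) * v$1 * cos (x$2) - sin (x$1) * sin (x$2) * v$2,
      cos (x$1) * v$1 * sin (x$2) + sin (x$1) * cos (x$2) * v$2,
      - sin (x$1) * v$1] :: real^3)"
  have nth: "((\<lambda>y::real^2. y $ k) has_derivative (\<lambda>v. v $ k)) (at x)" for k
    by (rule bounded_linear_imp_has_derivative) (rule bounded_linear_vec_nth)
  have vec: "(vector [a, b, c] :: real^3) = a *\<^sub>R axis 1 1 + b *\<^sub>R axis 2 1 + c *\<^sub>R axis 3 1" for a b c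
    by (simp add: vec_eq_iff forall_3 axis_def)
  have "(polar_param has_derivative D) (at x)"
    unfolding polar_param_def[abs_def] D_def vec
    by (auto intro!: derivative_eq_intros nth simp: fun_eq_iff algebra_simps)
  then have D: "frechet_derivative polar_param (at x) = D"
    by (rule frechet_derivative_at[symmetric])
  have 11: "D (axis 1 1) \<bullet> D (axis 1 1)
      = (cos (x$1))\<^sup>2 * ((cos (x$2))\<^sup>2 + (sin (x$2))\<^sup>2) + (sin (x$1))\<^sup>2"
    by (simp add: D_def inner_vec_def sum_3 axis_def algebra_simps power2_eq_square
             del: sin_cos_squared_add sin_cos_squared_add2 sin_cos_squared_add3)
  have 22: "D (axis 2 1) \<bullet> D (axis 2 1)
      = (sin (x$1))\<^sup>2 * ((cos (x$2))\<^sup>2 + (sin (x$2))\<^sup>2)"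
    by (simp add: D_def inner_vec_def sum_3 axis_def algebra_simps power2_eq_square
             del: sin_cos_squared_add sin_cos_squared_add2 sin_cos_squared_add3)
  have 12: "D (axis 1 1) \<bullet> D (axis 2 1) = 0" "D (axis 2 1) \<bullet> D (axis 1 1) = 0"
    by (simp_all add: D_def inner_vec_def sum_3 axis_def algebra_simps)
  have "\<forall>i j. D (axis i 1) \<bullet> D (axis j 1) = sphere_metric x $ i $ j"
    using 11 22 12 by (simp add: forall_2 sphere_metric_def)
  then show ?thesis by (simp add: D)
qed

end

theory Submission
  imports Defs
begin

text \<open>
  Write \<open>\<tau>\<close> for the tension field of \<open>\<phi>\<close>. The bitension field is \<open>J \<tau>\<close>, where J, the Jacobi operator of
  \<open>\<phi>\<close>, consists of the rough Laplacian and a curvature term. By the Leibniz rule for the rough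
  Laplacian, the expression \<open>f J \<tau> + (\<Delta>f) \<tau> + 2 \<nabla>\<^bsub>grad f\<^esub> \<tau>\<close> equals \<open>J (f \<tau>)\<close> (lemma \<open>f_jacobi_radial\<close>),
  so the map is f-biharmonic exactly when \<open>f \<tau>\<close> is a Jacobi field along it.

  For the map \<open>(r, \<theta>) \<mapsto> (r, k \<theta>)\<close> everything depends on r only. The tension field is
  \<open>(1 - k\<^sup>2) cot r \<partial>\<^sub>r\<close> (lemma \<open>tension_angular_dilation\<close>), and a radial field \<open>w(r) \<partial>\<^sub>r\<close> is a Jacobi
  field iff \<open>w'' + cot r w' - k\<^sup>2 (cos 2r / sin\<^sup>2 r) w = 0\<close> (lemma \<open>jacobi_operator_radial\<close>). In the variable
  \<open>s = ln (tan (r/2))\<close> this is a Poeschl-Teller equation, and for \<open>k = sqrt 3\<close> it is solved by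
  \<open>u(r) = (tan (r/2))\<^bsup>sqrt 3\<^esup> (1 + sqrt 3 cos r) (2 + sqrt 3 cos r)\<close> (lemma \<open>jacobi_profile_ode\<close>). Hence
  \<open>f = u tan r\<close> works, and so does a constant multiple on each interval where this function is nonzero
  and finite. The function in the theorem is a constant times \<open>\<bar>u tan r\<bar>\<close> (lemma \<open>weight_eq\<close>).

  This also explains the singular radii: at \<open>r = pi/2\<close> the tangent has a pole, where f is not
  continuous, and at \<open>r = 2 arctan (sqrt (2 + sqrt 3))\<close> the factor \<open>1 + sqrt 3 cos r\<close> has a simple zero, where
  the absolute value has a corner. Everywhere else f is the absolute value of a nonvanishing smooth
  function.
\<close>

section \<open>Calculus of smooth maps\<close>

text \<open>Each directional derivative is determined by the germ of the map, so on an open set agreement of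
  the maps propagates to derivatives of every order.\<close>

lemma Ck_on_cong:
  assumes "open S" "\<And>x. x \<in> S \<Longrightarrow> F x = G x" "Ck_on n S F"
  shows "Ck_on n S G"
  using assms(2,3)
proof (induction n arbitrary: F G)
  case 0
  then show ?case by (simp cong: continuous_on_cong)
next
  case (Suc n)
  have D: "(G has_derivative frechet_derivative F (at x)) (at x)" if "x \<in> S" for x
  proof (rule has_derivative_transform_within_open[OF _ \<open>open S\<close> that])
    show "(F has_derivative frechet_derivative F (at x)) (at x)"
      using Suc.prems(2) that by (simp add: frechet_derivative_works)
  qed (use Suc.prems(1) in auto)
  have eq: "frechet_derivative F (at x) = frechet_derivative G (at x)" if "x \<in> S" for x
    using D[OF that] by (rule frechet_derivative_at)
  have "Ck_on n S (\<lambda>x. frechet_derivative G (at x) v)" for v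
    by (rule Suc.IH[of "\<lambda>x. frechet_derivative F (at x) v"]) (use eq Suc.prems(2) in auto)
  then show ?case using D by (auto simp: differentiable_def)
qed

text \<open>The defining clause speaks of the chosen derivative \<open>frechet_derivative\<close>; by uniqueness of
  derivatives any explicit formula for the derivative serves equally well.\<close>

lemma Ck_on_SucI:
  assumes "open S" "\<And>x. x \<in> S \<Longrightarrow> (F has_derivative D x) (at x)"
    and "\<And>v. Ck_on n S (\<lambda>x. D x v)"
  shows "Ck_on (Suc n) S F"
proof -
  have eq: "D x = frechet_derivative F (at x)" if "x \<in> S" for x
    using assms(2)[OF that] by (rule frechet_derivative_at)
  have "Ck_on n S (\<lambda>x. frechet_derivative F (at x) v)" for v
    by (rule Ck_on_cong[OF assms(1) _ assms(3)[of v]]) (simp add: eq)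
  then show ?thesis using assms(2) by (auto simp: differentiable_def)
qed

lemma Ck_on_SucD:
  assumes "Ck_on (Suc n) S F"
  shows "x \<in> S \<Longrightarrow> (F has_derivative frechet_derivative F (at x)) (at x)"
    and "Ck_on n S (\<lambda>x. frechet_derivative F (at x) v)"
  using assms by (simp_all add: frechet_derivative_works)

lemma Ck_on_Suc_lower: "Ck_on (Suc n) S F \<Longrightarrow> Ck_on n S F"
proof (induction n arbitrary: F)
  case 0
  then show ?case
    by (auto intro!: continuous_at_imp_continuous_on differentiable_imp_continuous_within)
qed simp

lemma Ck_on_subset: "Ck_on n T F \<Longrightarrow> S \<subseteq> T \<Longrightarrow> Ck_on n S F"
proof (induction n arbitrary: F)
  case 0
  then show ?case by (auto intro: continuous_on_subset)
next
  case (Suc n)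
  then show ?case by (auto simp: Ck_on.simps(2))
qed

lemma Ck_on_const: "open S \<Longrightarrow> Ck_on n S (\<lambda>x. c)"
proof (induction n arbitrary: c)
  case (Suc n)
  show ?case by (rule Ck_on_SucI[where D = "\<lambda>x v. 0"]) (use Suc in auto)
qed simp

lemma Ck_on_linear:
  assumes "open S" "bounded_linear L"
  shows "Ck_on n S L"
proof (cases n)
  case 0
  then show ?thesis using assms(2) by (simp add: linear_continuous_on)
next
  case (Suc m)
  show ?thesis unfolding Suc
    by (rule Ck_on_SucI[where D = "\<lambda>x. L"])
      (use assms in \<open>auto intro: bounded_linear_imp_has_derivative Ck_on_const\<close>)
qed

declare Ck_on.simps(2) [simp del]

lemma Ck_on_add:
  assumes "open S" "Ck_on n S F" "Ck_on n S G"
  shows "Ck_on n S (\<lambda>x. F x + G x)"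
  using assms(2,3)
proof (induction n arbitrary: F G)
  case 0
  then show ?case by (simp add: continuous_on_add)
next
  case (Suc n)
  note F = Ck_on_SucD[OF Suc.prems(1)] and G = Ck_on_SucD[OF Suc.prems(2)]
  show ?case
    by (rule Ck_on_SucI[OF assms(1) has_derivative_add[OF F(1) G(1)]])
      (assumption | rule Suc.IH F(2) G(2))+
qed

text \<open>The Leibniz rule expresses the derivative of a product by products of the same kind, one order
  lower, so induction on the order closes.\<close>

lemma (in bounded_bilinear) Ck_on:
  assumes "open S" "Ck_on n S F" "Ck_on n S G"
  shows "Ck_on n S (\<lambda>x. prod (F x) (G x))"
  using assms(2,3)
proof (induction n arbitrary: F G)
  case 0
  then show ?case by (simp add: continuous_on)
next
  case (Suc n)
  note F = Ck_on_SucD[OF Suc.prems(1)] and G = Ck_on_SucD[OF Suc.prems(2)]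
  show ?case
  proof (rule Ck_on_SucI[OF assms(1) FDERIV[OF F(1) G(1)]])
    show "Ck_on n S (\<lambda>x. prod (F x) (frechet_derivative G (at x) v)
        + prod (frechet_derivative F (at x) v) (G x))" for v
      by (intro Ck_on_add Suc.IH assms(1) F(2) G(2) Suc.prems[THEN Ck_on_Suc_lower])
  qed
qed

lemmas Ck_on_mult = bounded_bilinear.Ck_on[OF bounded_bilinear_mult]

text \<open>For an outer function on the reals the chain rule turns the derivative of
  \<open>h \<circ> F\<close> into a product of a derivative of F and \<open>h' \<circ> F\<close>; the induction therefore has to run over
  all outer functions h at once.\<close>

lemma Ck_on_compose:
  fixes h :: "real \<Rightarrow> real"
  assumes "open S" "open T" "F ` S \<subseteq> T" "Ck_on n T h" "Ck_on n S F"
  shows "Ck_on n S (\<lambda>x. h (F x))"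
  using assms(4,5)
proof (induction n arbitrary: h)
  case 0
  then show ?case using assms(3) by (auto intro: continuous_on_compose2)
next
  case (Suc n)
  note h = Ck_on_SucD[OF Suc.prems(1)] and F = Ck_on_SucD[OF Suc.prems(2)]
  have D: "((\<lambda>x. h (F x)) has_derivative
      (\<lambda>v. frechet_derivative F (at x) v * frechet_derivative h (at (F x)) 1)) (at x)" if "x \<in> S" for x
  proof -
    have hx: "(h has_derivative frechet_derivative h (at (F x))) (at (F x))"
      using h(1) assms(3) that by blast
    then interpret bounded_linear "frechet_derivative h (at (F x))"
      by (rule has_derivative_bounded_linear)
    define c where "c = frechet_derivative h (at (F x)) 1"
    have "frechet_derivative h (at (F x)) w = w * c" for w
      using scaleR[of w 1] by (simp add: c_def)
    then have "((\<lambda>x. h (F x)) has_derivative (\<lambda>v. frechet_derivative F (at x) v * c)) (at x)"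
      using has_derivative_compose[OF F(1)[OF that] hx] by simp
    then show ?thesis unfolding c_def .
  qed
  show ?case
  proof (rule Ck_on_SucI[OF assms(1) D])
    show "Ck_on n S (\<lambda>x. frechet_derivative F (at x) v * frechet_derivative h (at (F x)) 1)" for v
      by (rule Ck_on_mult[OF assms(1) F(2) Suc.IH[OF h(2) Ck_on_Suc_lower[OF Suc.prems(2)]]])
  qed
qed

text \<open>The elementary functions below have derivatives that are expressed through functions of the same
  family, and this rule makes their smoothness an induction on the order.\<close>

lemma Ck_on_DERIV:
  fixes h :: "real \<Rightarrow> real"
  assumes "open T" "\<And>x. x \<in> T \<Longrightarrow> (h has_real_derivative h' x) (at x)" "Ck_on n T h'"
  shows "Ck_on (Suc n) T h"
proof (rule Ck_on_SucI[OF assms(1)])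
  show "(h has_derivative (*) (h' x)) (at x)" if "x \<in> T" for x
    using assms(2)[OF that] by (simp add: has_field_derivative_def)
  show "Ck_on n T (\<lambda>x. h' x * v)" for v
    by (rule Ck_on_mult[OF assms(1,3) Ck_on_const[OF assms(1)]])
qed

text \<open>Differentiation exchanges the two functions, hence the joint induction.\<close>

lemma Ck_on_sin_cos:
  "Ck_on n (UNIV :: real set) sin \<and> Ck_on n (UNIV :: real set) cos"
proof (induction n)
  case 0
  show ?case by (auto intro: continuous_intros)
next
  case (Suc n)
  have "Ck_on n UNIV (\<lambda>x::real. (-1) * sin x)"
    by (intro Ck_on_mult Ck_on_const) (use Suc in auto)
  then have "Ck_on (Suc n) (UNIV :: real set) cos"
    by (intro Ck_on_DERIV[where h' = "\<lambda>x. (-1) * sin x"]) (auto intro!: derivative_eq_intros)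
  moreover have "Ck_on (Suc n) (UNIV :: real set) sin"
    by (rule Ck_on_DERIV[where h' = cos]) (use Suc in \<open>auto intro!: derivative_eq_intros\<close>)
  ultimately show ?case by simp
qed

lemma Ck_on_inverse: "Ck_on n (- {0 :: real}) inverse"
proof (induction n)
  case 0
  show ?case by (auto intro: continuous_intros)
next
  case (Suc n)
  have "Ck_on n (- {0}) (\<lambda>x::real. (-1) * (inverse x * inverse x))"
    by (intro Ck_on_mult Ck_on_const) (use Suc in auto)
  then show ?case
    by (intro Ck_on_DERIV[where h' = "\<lambda>x. (-1) * (inverse x * inverse x)"])
      (auto intro!: derivative_eq_intros)
qed

lemma Ck_on_powr: "Ck_on n {0 :: real<..} (\<lambda>x. x powr a)"
proof (induction n arbitrary: a)
  case 0
  show ?case by (auto intro!: continuous_intros)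
next
  case (Suc n)
  have "Ck_on n {0<..} (\<lambda>x::real. a * x powr (a - 1))"
    by (intro Ck_on_mult Ck_on_const) (use Suc in auto)
  then show ?case
    by (intro Ck_on_DERIV[where h' = "\<lambda>x. a * x powr (a - 1)"])
      (auto intro!: derivative_eq_intros)
qed

text \<open>Away from 0 the derivative of the absolute value is the sign, which is locally constant.\<close>

lemma Ck_on_abs: "Ck_on n (- {0 :: real}) abs"
proof (cases n)
  case 0
  then show ?thesis by (auto intro!: continuous_intros)
next
  case (Suc m)
  have abs: "(abs has_real_derivative sgn x) (at x)" if "x \<noteq> 0" for x :: real
    by (rule has_field_derivative_transform_within_open[
          where S = "if x > 0 then {0<..} else {..<0}" and f = "\<lambda>y. sgn x * y"])
      (use that in \<open>auto intro!: derivative_eq_intros split: if_splits\<close>)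
  have sgn: "(sgn has_real_derivative 0) (at x)" if "x \<noteq> 0" for x :: real
    by (rule has_field_derivative_transform_within_open[
          where S = "if x > 0 then {0<..} else {..<0}" and f = "\<lambda>y. sgn x"])
      (use that in \<open>auto split: if_splits\<close>)
  have "Ck_on m (- {0 :: real}) sgn"
  proof (cases m)
    case 0
    then show ?thesis by (auto intro!: continuous_intros)
  next
    case (Suc l)
    show ?thesis unfolding Suc
      by (rule Ck_on_DERIV[where h' = "\<lambda>x. 0"]) (auto intro: sgn Ck_on_const)
  qed
  then show ?thesis unfolding Suc
    by (intro Ck_on_DERIV[where h' = sgn]) (auto intro: abs)
qed

lemma smooth_at_imp_differentiable: "smooth_at F x \<Longrightarrow> F differentiable (at x)"
  using Ck_on.simps(2) unfolding smooth_at_def smooth_on_def by metis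

lemma smooth_at_cong:
  assumes "open S" "x \<in> S" "\<And>y. y \<in> S \<Longrightarrow> F y = G y"
  shows "smooth_at F x \<longleftrightarrow> smooth_at G x"
proof -
  have "smooth_at G x" if F: "smooth_at F x" and eq: "\<And>y. y \<in> S \<Longrightarrow> F y = G y" for F G :: "'a \<Rightarrow> 'b"
  proof -
    obtain T where T: "x \<in> T" "open T" "\<And>n. Ck_on n T F"
      using F by (auto simp: smooth_at_def smooth_on_def)
    have "Ck_on n (S \<inter> T) G" for n
      by (rule Ck_on_cong[where F = F]) (use T assms(1) eq in \<open>auto intro: Ck_on_subset\<close>)
    then show ?thesis
      unfolding smooth_at_def smooth_on_def using T assms(1,2) by blast
  qed
  then show ?thesis using assms(3) by metis
qed

section \<open>The polar chart of the sphere and angular dilations\<close>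

text \<open>For k = 1 this is the identity map, so every computation of its pullback connection contains
  the Levi-Civita connection of the sphere as a special case.\<close>

definition angular_dilation :: "real \<Rightarrow> real^2 \<Rightarrow> real^2" where
  "angular_dilation k x = vector [x $ 1, k * x $ 2]"

lemma vec2_eq_iff: "x = y \<longleftrightarrow> x $ 1 = y $ 1 \<and> x $ 2 = y $ 2" for x y :: "'a^2"
  by (simp add: vec_eq_iff forall_2)

lemma vector2_decomp: "(vector [a, b] :: real^2) = a *\<^sub>R axis 1 1 + b *\<^sub>R axis 2 1"
  by (simp add: vec2_eq_iff axis_def)

lemma dir_deriv_eq:
  "(F has_derivative D) (at p) \<Longrightarrow> dir_deriv X F p = D (X p)"
  unfolding dir_deriv_def using frechet_derivative_at by metis

lemma open_radial: "open I \<Longrightarrow> open {x :: real^2. x $ 1 \<in> I}"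
  using open_vimage[of I "\<lambda>q :: real^2. q $ 1"] by (simp add: vimage_def continuous_on_component)

text \<open>The fields and functions that occur depend on the distance r from the pole only, so their
  derivatives reduce to ordinary ones. The open set I is there because iterated covariant
  derivatives need the first derivative in a neighbourhood, while the regular radii do not fill
  the whole interval.\<close>

lemma has_derivative_radial:
  fixes p :: "real^2"
  assumes "open I" "p $ 1 \<in> I" "\<And>q :: real^2. q $ 1 \<in> I \<Longrightarrow> F q = G (q $ 1)"
    and "(G has_vector_derivative G') (at (p $ 1))"
  shows "(F has_derivative (\<lambda>v. v $ 1 *\<^sub>R G')) (at p)"
proof (rule has_derivative_transform_within_open)
  show "((\<lambda>q. G (q $ 1)) has_derivative (\<lambda>v. v $ 1 *\<^sub>R G')) (at p)"
    by (rule has_derivative_compose[of "\<lambda>q. q $ 1" "\<lambda>v. v $ 1"])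
      (use assms(4) in \<open>auto simp: has_vector_derivative_def
        intro!: bounded_linear_imp_has_derivative bounded_linear_vec_nth\<close>)
  show "open {q :: real^2. q $ 1 \<in> I}"
    using assms(1) by (rule open_radial)
qed (use assms in auto)

lemma dir_deriv_radial:
  fixes p :: "real^2" and G :: "real \<Rightarrow> real"
  assumes "open I" "p $ 1 \<in> I" "\<And>q :: real^2. q $ 1 \<in> I \<Longrightarrow> F q = G (q $ 1)"
    and "(G has_real_derivative G') (at (p $ 1))"
  shows "dir_deriv X F p = X p $ 1 * G'"
proof -
  have "(G has_vector_derivative G') (at (p $ 1))"
    using assms(4) by (simp add: has_real_derivative_iff_has_vector_derivative)
  from dir_deriv_eq[OF has_derivative_radial[OF assms(1-3) this]] show ?thesis by simp
qed

lemma dir_deriv_radial_vector: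
  fixes p :: "real^2" and W :: "real^2 \<Rightarrow> real^2"
  assumes "open I" "p $ 1 \<in> I" "\<And>q :: real^2. q $ 1 \<in> I \<Longrightarrow> W q = vector [a (q $ 1), b (q $ 1)]"
    and "(a has_real_derivative a') (at (p $ 1))" "(b has_real_derivative b') (at (p $ 1))"
  shows "dir_deriv X W p = vector [X p $ 1 * a', X p $ 1 * b' :: real]"
proof -
  have "((\<lambda>r. vector [a r, b r] :: real^2) has_vector_derivative vector [a', b']) (at (p $ 1))"
    unfolding vector2_decomp
    using assms(4,5)
    by (auto intro!: derivative_eq_intros simp: has_real_derivative_iff_has_vector_derivative)
  from dir_deriv_eq[OF has_derivative_radial[OF assms(1-3) this]] show ?thesis
    by (simp add: vec2_eq_iff)
qed

lemma sphere_metric_nth: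
  "sphere_metric q $ 1 $ 1 = 1" "sphere_metric q $ 1 $ 2 = 0"
  "sphere_metric q $ 2 $ 1 = 0" "sphere_metric q $ 2 $ 2 = (sin (q $ 1))\<^sup>2"
  by (simp_all add: sphere_metric_def)

text \<open>The inverse matrix is a choice among two-sided inverses, and associativity leaves only one.\<close>

lemma matrix_inv_sphere_metric:
  assumes "sin (q $ 1) \<noteq> 0"
  shows "matrix_inv (sphere_metric q) $ 1 $ 1 = 1" "matrix_inv (sphere_metric q) $ 1 $ 2 = 0"
    "matrix_inv (sphere_metric q) $ 2 $ 1 = 0"
    "matrix_inv (sphere_metric q) $ 2 $ 2 = 1 / (sin (q $ 1))\<^sup>2"
proof -
  define B :: "real^2^2" where "B = vector [vector [1, 0], vector [0, 1 / (sin (q $ 1))\<^sup>2]]"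
  have B: "sphere_metric q ** B = mat 1" "B ** sphere_metric q = mat 1"
    using assms by (simp_all add: vec2_eq_iff matrix_matrix_mult_def sum_2 sphere_metric_nth B_def mat_def)
  have "matrix_inv (sphere_metric q) = B"
    unfolding matrix_inv_def
  proof (rule some_equality)
    fix C assume "sphere_metric q ** C = mat 1 \<and> C ** sphere_metric q = mat 1"
    then show "C = B"
      using B by (metis matrix_mul_assoc matrix_mul_lid matrix_mul_rid)
  qed (use B in simp)
  then show "matrix_inv (sphere_metric q) $ 1 $ 1 = 1" "matrix_inv (sphere_metric q) $ 1 $ 2 = 0"
    "matrix_inv (sphere_metric q) $ 2 $ 1 = 0"
    "matrix_inv (sphere_metric q) $ 2 $ 2 = 1 / (sin (q $ 1))\<^sup>2"
    by (simp_all add: B_def)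
qed

lemma riemannian_metric_on_sphere:
  assumes "open U" "U \<subseteq> polar_domain"
  shows "riemannian_metric_on U sphere_metric"
proof -
  have lin: "Ck_on n U (\<lambda>x :: real^2. x $ 1)" for n
    by (rule Ck_on_linear[OF assms(1) bounded_linear_vec_nth])
  have sin: "Ck_on n U (\<lambda>x :: real^2. sin (x $ 1))" for n
    by (rule Ck_on_compose[OF assms(1) open_UNIV _ _ lin]) (use Ck_on_sin_cos in auto)
  define E where "E i = ((\<chi> k l. if k = i \<and> l = i then 1 else 0) :: real^2^2)" for i
  have eq: "sphere_metric = (\<lambda>x. E 1 + (sin (x $ 1) * sin (x $ 1)) *\<^sub>R E 2)"
    by (simp add: fun_eq_iff vec2_eq_iff sphere_metric_nth E_def power2_eq_square)
  have "Ck_on n U sphere_metric" for n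
    unfolding eq
    by (rule Ck_on_add[OF assms(1) Ck_on_const[OF assms(1)]
        bounded_bilinear.Ck_on[OF bounded_bilinear_scaleR assms(1) Ck_on_mult[OF assms(1) sin sin] Ck_on_const[OF assms(1)]]])
  moreover have "v \<bullet> (sphere_metric x *v v) > 0" if "x \<in> U" "v \<noteq> 0" for x v
  proof -
    have "sin (x $ 1) > 0" using that assms(2) by (auto simp: polar_domain_def intro: sin_gt_zero)
    moreover have "v \<bullet> (sphere_metric x *v v) = (v $ 1)\<^sup>2 + (sin (x $ 1) * v $ 2)\<^sup>2"
      by (simp add: inner_vec_def matrix_vector_mult_def sum_2 sphere_metric_nth power2_eq_square)
    ultimately show ?thesis
      using that(2) by (auto simp: vec2_eq_iff sum_power2_gt_zero_iff)
  qed
  moreover have "transpose (sphere_metric x) = sphere_metric x" for x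
    by (simp add: vec2_eq_iff transpose_def sphere_metric_nth)
  ultimately show ?thesis
    using assms(1) by (simp add: riemannian_metric_on_def smooth_on_def)
qed

lemma dir_deriv_sphere_metric:
  "dir_deriv X (\<lambda>q. sphere_metric q $ i $ j) p =
     (if i = 2 \<and> j = 2 then X p $ 1 * (2 * sin (p $ 1) * cos (p $ 1)) else 0)"
proof -
  have 22: "dir_deriv X (\<lambda>q. (sin (q $ 1))\<^sup>2) p = X p $ 1 * (2 * sin (p $ 1) * cos (p $ 1))"
    by (rule dir_deriv_radial[where I = UNIV and G = "\<lambda>r. (sin r)\<^sup>2"])
      (auto intro!: derivative_eq_intros)
  have const: "dir_deriv X (\<lambda>q. c :: real) p = 0" for c
    by (simp add: dir_deriv_def)
  show ?thesis
    using exhaust_2[of i] exhaust_2[of j] by (auto simp: sphere_metric_nth 22 const)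
qed

lemma christoffel_sphere:
  assumes "sin (p $ 1) \<noteq> 0"
  shows "christoffel sphere_metric 1 1 1 p = 0" "christoffel sphere_metric 1 1 2 p = 0"
    "christoffel sphere_metric 1 2 1 p = 0"
    "christoffel sphere_metric 1 2 2 p = - sin (p $ 1) * cos (p $ 1)"
    "christoffel sphere_metric 2 1 1 p = 0" "christoffel sphere_metric 2 2 2 p = 0"
    "christoffel sphere_metric 2 1 2 p = cot (p $ 1)"
    "christoffel sphere_metric 2 2 1 p = cot (p $ 1)"
  using assms
  by (simp_all add: christoffel_def sum_2 dir_deriv_sphere_metric matrix_inv_sphere_metric
      coord_field_def axis_def cot_def power2_eq_square)

lemma bounded_linear_angular_dilation: "bounded_linear (angular_dilation k)"
  unfolding linear_conv_bounded_linear[symmetric]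
  by (rule linearI) (simp_all add: angular_dilation_def vec2_eq_iff algebra_simps)

lemma dir_deriv_angular_dilation:
  "dir_deriv X (angular_dilation k) p = angular_dilation k (X p)"
  by (rule dir_deriv_eq[OF bounded_linear_imp_has_derivative[OF bounded_linear_angular_dilation]])

text \<open>The dilation fixes the radial coordinate, so the Christoffel symbols are evaluated at the same r
  on both sides; k enters only through the derivative of the map in the angular direction.\<close>

lemma pullback_conn_radial:
  fixes p :: "real^2" and W :: "real^2 \<Rightarrow> real^2"
  assumes "open I" "p $ 1 \<in> I" "\<And>q :: real^2. q $ 1 \<in> I \<Longrightarrow> W q = vector [a (q $ 1), b (q $ 1)]"
    and "(a has_real_derivative a') (at (p $ 1))" "(b has_real_derivative b') (at (p $ 1))"
    and "sin (p $ 1) \<noteq> 0"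
  shows "pullback_conn sphere_metric (angular_dilation k) X W p =
    vector [X p $ 1 * a' - k * X p $ 2 * sin (p $ 1) * cos (p $ 1) * b (p $ 1),
      X p $ 1 * (b' + cot (p $ 1) * b (p $ 1)) + k * X p $ 2 * cot (p $ 1) * a (p $ 1)]"
proof -
  have "sin (angular_dilation k p $ 1) \<noteq> 0" "angular_dilation k p $ 1 = p $ 1"
    using assms(6) by (simp_all add: angular_dilation_def)
  note chr = christoffel_sphere[OF this(1), unfolded this(2)]
  show ?thesis
    by (simp add: pullback_conn_def dir_deriv_radial_vector[OF assms(1-5)] dir_deriv_angular_dilation
        vec2_eq_iff sum_2 chr assms(2,3)) (simp add: angular_dilation_def algebra_simps)
qed

lemma pullback_conn_const:
  assumes "sin (p $ 1) \<noteq> 0"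
  shows "pullback_conn sphere_metric (angular_dilation k) X (\<lambda>_. w) p =
    vector [- k * X p $ 2 * sin (p $ 1) * cos (p $ 1) * w $ 2,
      cot (p $ 1) * (X p $ 1 * w $ 2 + k * X p $ 2 * w $ 1)]"
proof -
  have "w = vector [w $ 1, w $ 2]" by (simp add: vec2_eq_iff)
  from pullback_conn_radial[OF open_UNIV UNIV_I this DERIV_const DERIV_const assms] 
  show ?thesis by (simp add: algebra_simps)
qed

lemma levi_civita_eq_pullback_conn: "levi_civita g X Y = pullback_conn g (angular_dilation 1) X Y"
proof -
  have "angular_dilation 1 = (\<lambda>x. x)"
    by (simp add: angular_dilation_def vec2_eq_iff fun_eq_iff)
  then show ?thesis
    by (simp add: levi_civita_def pullback_conn_def dir_deriv_def)
qed

lemmas levi_civita_radial =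
  pullback_conn_radial[where k = 1, folded levi_civita_eq_pullback_conn, simplified]

lemma levi_civita_const:
  assumes "sin (p $ 1) \<noteq> 0"
  shows "levi_civita sphere_metric X (\<lambda>_. w) p =
    vector [- X p $ 2 * sin (p $ 1) * cos (p $ 1) * w $ 2,
      cot (p $ 1) * (X p $ 1 * w $ 2 + X p $ 2 * w $ 1)]"
  using pullback_conn_const[OF assms, of 1 X w] by (simp add: levi_civita_eq_pullback_conn)

lemma coord_field_nth:
  "coord_field 1 q $ 1 = 1" "coord_field 1 q $ 2 = 0" "coord_field 2 q $ 1 = 0" "coord_field 2 q $ 2 = 1"
  for q :: "real^2"
  by (simp_all add: coord_field_def axis_def)

lemma open_sin_nonzero: "open {r :: real. sin r \<noteq> 0}"
  by (intro open_Collect_neq continuous_intros)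

text \<open>This is constant curvature 1. In polar coordinates it comes from
  \<open>cot' = - (1 + cot\<^sup>2)\<close> and \<open>(sin * cos)' = cos\<^sup>2 - sin\<^sup>2\<close>.\<close>

lemma curvature_sphere:
  assumes s: "sin (p $ 1) \<noteq> 0"
  shows "curvature_at sphere_metric p u v w =
     (v \<bullet> (sphere_metric p *v w)) *\<^sub>R u - (u \<bullet> (sphere_metric p *v w)) *\<^sub>R v"
proof -
  have *: "levi_civita sphere_metric (\<lambda>_. x) (levi_civita sphere_metric (\<lambda>_. y) (\<lambda>_. w)) p =
     vector [- x $ 1 * y $ 2 * w $ 2 * ((cos (p $ 1))\<^sup>2 - (sin (p $ 1))\<^sup>2)
        - x $ 2 * (cos (p $ 1))\<^sup>2 * (y $ 1 * w $ 2 + y $ 2 * w $ 1),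
       (y $ 1 * w $ 2 + y $ 2 * w $ 1) * x $ 1 * (cot (p $ 1) ^ 2 - 1 / (sin (p $ 1))\<^sup>2)
        - x $ 2 * (cos (p $ 1))\<^sup>2 * y $ 2 * w $ 2]" for x y
  proof -
    have D1: "((\<lambda>r. - y $ 2 * sin r * cos r * w $ 2) has_real_derivative
        - y $ 2 * w $ 2 * ((cos (p $ 1))\<^sup>2 - (sin (p $ 1))\<^sup>2)) (at (p $ 1))"
      by (auto intro!: derivative_eq_intros simp: power2_eq_square algebra_simps)
    have D2: "((\<lambda>r. cot r * (y $ 1 * w $ 2 + y $ 2 * w $ 1)) has_real_derivative
        - (1 / (sin (p $ 1))\<^sup>2) * (y $ 1 * w $ 2 + y $ 2 * w $ 1)) (at (p $ 1))"
      using s by (auto intro!: derivative_eq_intros DERIV_cot simp: field_simps power2_eq_square)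
    show ?thesis
      using levi_civita_radial[OF open_sin_nonzero _ levi_civita_const D1 D2 s, of "\<lambda>_. x"] s
      by (simp add: vec2_eq_iff cot_def) (simp add: field_simps power2_eq_square)
  qed
  have "lie_bracket (\<lambda>_. u) (\<lambda>_. v) = (\<lambda>_. 0)"
    by (simp add: lie_bracket_def dir_deriv_def fun_eq_iff)
  then have br: "levi_civita sphere_metric (lie_bracket (\<lambda>_. u) (\<lambda>_. v)) (\<lambda>_. w) p = 0"
    using levi_civita_const[OF s, of "\<lambda>_. 0" w] by (simp add: vec2_eq_iff)
  have c: "(cos (p $ 1))\<^sup>2 = 1 - (sin (p $ 1))\<^sup>2" by (rule cos_squared_eq)
  have ct: "cot (p $ 1) ^ 2 = 1 / (sin (p $ 1))\<^sup>2 - 1"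
    using s by (simp add: cot_def power_divide c field_simps)
  show ?thesis
    unfolding curvature_at_def curvature_def br *
    by (simp add: vec2_eq_iff inner_vec_def matrix_vector_mult_def sum_2 sphere_metric_nth c ct)
      (simp add: algebra_simps)
qed

section \<open>Tension field and Jacobi operator of an angular dilation\<close>

lemma dir_deriv_coord_angular_dilation:
  "dir_deriv (coord_field j) (angular_dilation k) = (\<lambda>_. angular_dilation k (axis j 1))"
  by (simp add: fun_eq_iff dir_deriv_angular_dilation coord_field_def)

lemma metric_trace_sphere:
  assumes "sin (p $ 1) \<noteq> 0"
  shows "metric_trace sphere_metric B p = B (coord_field 1) (coord_field 1) p
     + (1 / (sin (p $ 1))\<^sup>2) *\<^sub>R B (coord_field 2) (coord_field 2) p"
  by (simp add: metric_trace_def sum_2 matrix_inv_sphere_metric assms)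

lemma levi_civita_coord:
  assumes "sin (p $ 1) \<noteq> 0"
  shows "levi_civita sphere_metric (coord_field 1) (coord_field 1) p = 0"
    "levi_civita sphere_metric (coord_field 2) (coord_field 2) p = vector [- sin (p $ 1) * cos (p $ 1), 0]"
  using levi_civita_const[OF assms]
  by (simp_all add: coord_field_def[of 1] coord_field_def[of 2] vec2_eq_iff axis_def)

text \<open>The meridians are mapped to meridians with unit speed and contribute nothing. The parallels
  contribute the sum of two radial terms: \<open>- k\<^sup>2 cot r\<close>, the acceleration of the image of a
  parallel, and \<open>cot r\<close>, from the curvature of the parallel in the source.\<close>

lemma tension_angular_dilation:
  assumes s: "sin (p $ 1) \<noteq> 0"
  shows "tension sphere_metric sphere_metric (angular_dilation k) p = vector [(1 - k\<^sup>2) * cot (p $ 1), 0]"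
  unfolding tension_def metric_trace_sphere[OF s] second_fundamental_form_def
    dir_deriv_coord_angular_dilation pullback_conn_const[OF s] dir_deriv_angular_dilation levi_civita_coord[OF s]
  using s by (simp add: vec2_eq_iff coord_field_nth angular_dilation_def axis_def cot_def)
    (simp add: field_simps power2_eq_square)

text \<open>The second variation operator of the energy at \<open>\<phi>\<close>, up to sign.\<close>

definition jacobi_operator ::
    "'n::finite metric \<Rightarrow> 'm::finite metric \<Rightarrow> (real^'n \<Rightarrow> real^'m) \<Rightarrow> (real^'n \<Rightarrow> real^'m)
      \<Rightarrow> real^'n \<Rightarrow> real^'m" where
  "jacobi_operator g h \<phi> V = (\<lambda>x. rough_laplacian g h \<phi> V x
     - metric_trace g (\<lambda>X Y x. curvature_at h (\<phi> x) (dir_deriv X \<phi> x) (V x) (dir_deriv Y \<phi> x)) x)"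

lemma bitension_eq_jacobi: "bitension g h \<phi> = jacobi_operator g h \<phi> (tension g h \<phi>)"
  by (simp add: bitension_def jacobi_operator_def)

text \<open>The rough Laplacian contributes the potential \<open>- k\<^sup>2 cot\<^sup>2 r\<close> and the curvature of the target
  contributes \<open>k\<^sup>2\<close>; their sum is \<open>- k\<^sup>2 cos 2r / sin\<^sup>2 r\<close>.\<close>

lemma jacobi_operator_radial:
  fixes p :: "real^2" and V :: "real^2 \<Rightarrow> real^2"
  assumes I: "open I" "p $ 1 \<in> I" "\<And>r. r \<in> I \<Longrightarrow> sin r \<noteq> 0"
    and V: "\<And>q :: real^2. q $ 1 \<in> I \<Longrightarrow> V q = vector [w (q $ 1), 0]"
    and w: "\<And>r. r \<in> I \<Longrightarrow> (w has_real_derivative w' r) (at r)"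
      "(w' has_real_derivative w'') (at (p $ 1))"
  shows "jacobi_operator sphere_metric sphere_metric (angular_dilation k) V p =
    vector [w'' + cot (p $ 1) * w' (p $ 1)
      - k\<^sup>2 * cos (2 * p $ 1) / (sin (p $ 1))\<^sup>2 * w (p $ 1), 0]"
proof -
  let ?D = "pullback_conn sphere_metric (angular_dilation k)"
  have s: "sin (p $ 1) \<noteq> 0" using I by blast
  have D: "?D X V q = vector [X q $ 1 * w' (q $ 1), k * X q $ 2 * cot (q $ 1) * w (q $ 1)]"
    if "q $ 1 \<in> I" for q X
    using pullback_conn_radial[OF I(1) that V w(1)[OF that] DERIV_const I(3)[OF that]] by simp
  have dcot: "((\<lambda>r. k * cot r * w r) has_real_derivative
      k * (cot (p $ 1) * w' (p $ 1) - w (p $ 1) / (sin (p $ 1))\<^sup>2)) (at (p $ 1))"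
    using s by (auto intro!: derivative_eq_intros DERIV_cot w(1) I(2) simp: field_simps)
  have D11: "?D (coord_field 1) (?D (coord_field 1) V) p = vector [w'', 0]"
    using pullback_conn_radial[OF I(1,2) _ w(2) DERIV_const s, of "?D (coord_field 1) V" 0 k "coord_field 1"] D
    by (simp add: coord_field_nth)
  have D22: "?D (coord_field 2) (?D (coord_field 2) V) p
      = vector [- k\<^sup>2 * (cos (p $ 1))\<^sup>2 * w (p $ 1), 0]"
    using pullback_conn_radial[OF I(1,2) _ DERIV_const dcot s, of "?D (coord_field 2) V" 0 k "coord_field 2"] D s
    by (simp add: coord_field_nth cot_def power2_eq_square ac_simps)
  have R: "metric_trace sphere_metric (\<lambda>X Y x. curvature_at sphere_metric (angular_dilation k x)
        (dir_deriv X (angular_dilation k) x) (V x) (dir_deriv Y (angular_dilation k) x)) p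
      = vector [- k\<^sup>2 * w (p $ 1), 0]"
  proof -
    have 1: "angular_dilation k p $ 1 = p $ 1" by (simp add: angular_dilation_def)
    show ?thesis
      using s by (simp add: metric_trace_sphere curvature_sphere 1 dir_deriv_angular_dilation V[OF I(2)])
       (simp add: vec2_eq_iff inner_vec_def matrix_vector_mult_def sum_2 sphere_metric_nth
          angular_dilation_def coord_field_nth power2_eq_square)
  qed
  show ?thesis
    unfolding jacobi_operator_def R rough_laplacian_def metric_trace_sphere[OF s] D11 D22
      levi_civita_coord[OF s] D[OF I(2)]
    using s by (simp add: vec2_eq_iff D I(2) levi_civita_coord cot_def cos_double) (simp add: field_simps power2_eq_square)
qed

lemma laplacian_radial:
  fixes p :: "real^2" and F :: "real^2 \<Rightarrow> real"
  assumes I: "open I" "p $ 1 \<in> I" "sin (p $ 1) \<noteq> 0"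
    and F: "\<And>q :: real^2. q $ 1 \<in> I \<Longrightarrow> F q = f (q $ 1)"
    and f: "\<And>r. r \<in> I \<Longrightarrow> (f has_real_derivative f' r) (at r)"
      "(f' has_real_derivative f'') (at (p $ 1))"
  shows "laplacian sphere_metric F p = f'' + cot (p $ 1) * f' (p $ 1)"
proof -
  have D: "dir_deriv X F q = X q $ 1 * f' (q $ 1)" if "q $ 1 \<in> I" for q X
    using dir_deriv_radial[OF I(1) that F f(1)[OF that]] .
  have D11: "dir_deriv (coord_field 1) (dir_deriv (coord_field 1) F) p = f''"
    using dir_deriv_radial[OF I(1,2) _ f(2), of "dir_deriv (coord_field 1) F" "coord_field 1"] D
    by (simp add: coord_field_nth)
  have D22: "dir_deriv (coord_field 2) (dir_deriv (coord_field 2) F) p = 0"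
    using dir_deriv_radial[OF I(1,2) _ DERIV_const, of "dir_deriv (coord_field 2) F" 0 "coord_field 2"] D
    by (simp add: coord_field_nth)
  show ?thesis
    unfolding laplacian_def metric_trace_sphere[OF I(3)] hessian_def D11 D22 D[OF I(2)] levi_civita_coord[OF I(3)]
    using I(3) by (simp add: cot_def power2_eq_square)
qed

lemma gradient_radial:
  fixes p :: "real^2" and F :: "real^2 \<Rightarrow> real"
  assumes I: "open I" "p $ 1 \<in> I" "sin (p $ 1) \<noteq> 0"
    and F: "\<And>q :: real^2. q $ 1 \<in> I \<Longrightarrow> F q = f (q $ 1)"
    and f: "(f has_real_derivative f') (at (p $ 1))"
  shows "gradient sphere_metric F p = vector [f', 0]"
  using dir_deriv_radial[OF I(1,2) F f] I(3)
  by (simp add: gradient_def vec2_eq_iff matrix_vector_mult_def sum_2 matrix_inv_sphere_metric coord_field_nth)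

text \<open>The Leibniz rule \<open>\<Delta>(F V) = F \<Delta>V + 2 \<nabla>\<^bsub>grad F\<^esub> V + (\<Delta>F) V\<close> for the rough Laplacian, together with the
  linearity of the curvature term. With V the tension field the left-hand side is the expression
  that has to vanish for an f-biharmonic map.\<close>

lemma f_jacobi_radial:
  fixes p :: "real^2" and V :: "real^2 \<Rightarrow> real^2" and F :: "real^2 \<Rightarrow> real"
  assumes I: "open I" "p $ 1 \<in> I" "\<And>r. r \<in> I \<Longrightarrow> sin r \<noteq> 0"
    and V: "\<And>q :: real^2. q $ 1 \<in> I \<Longrightarrow> V q = vector [w (q $ 1), 0]"
    and w: "\<And>r. r \<in> I \<Longrightarrow> (w has_real_derivative w' r) (at r)"
      "(w' has_real_derivative w'') (at (p $ 1))"
    and F: "\<And>q :: real^2. q $ 1 \<in> I \<Longrightarrow> F q = f (q $ 1)"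
    and f: "\<And>r. r \<in> I \<Longrightarrow> (f has_real_derivative f' r) (at r)"
      "(f' has_real_derivative f'') (at (p $ 1))"
  shows "F p *\<^sub>R jacobi_operator sphere_metric sphere_metric (angular_dilation k) V p
      + laplacian sphere_metric F p *\<^sub>R V p
      + 2 *\<^sub>R pullback_conn sphere_metric (angular_dilation k) (gradient sphere_metric F) V p
    = jacobi_operator sphere_metric sphere_metric (angular_dilation k) (\<lambda>q. F q *\<^sub>R V q) p"
proof -
  have s: "sin (p $ 1) \<noteq> 0" using I by blast
  have prod: "((\<lambda>r. f r * w r) has_real_derivative f' r * w r + f r * w' r) (at r)" if "r \<in> I" for r
    by (auto intro!: derivative_eq_intros f(1) w(1) that)
  have prod': "((\<lambda>r. f' r * w r + f r * w' r) has_real_derivative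
      f'' * w (p $ 1) + 2 * f' (p $ 1) * w' (p $ 1) + f (p $ 1) * w'') (at (p $ 1))"
    by (auto intro!: derivative_eq_intros f(1) w(1) f(2) w(2) I(2))
  have FV: "F q *\<^sub>R V q = vector [f (q $ 1) * w (q $ 1), 0]" if "q $ 1 \<in> I" for q
    using that by (simp add: F V vec2_eq_iff)
  note grad = gradient_radial[OF I(1,2) s F f(1)[OF I(2)]]
  have D: "pullback_conn sphere_metric (angular_dilation k) (gradient sphere_metric F) V p
      = vector [f' (p $ 1) * w' (p $ 1), 0]"
    using pullback_conn_radial[OF I(1,2) V w(1)[OF I(2)] DERIV_const s, of k "gradient sphere_metric F"]
    by (simp add: grad)
  show ?thesis
    by (simp add: D jacobi_operator_radial[where I = I and V = V and w = w, OF I V w]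
        laplacian_radial[where I = I and F = F and f = f, OF I(1,2) s F f]
        jacobi_operator_radial[where I = I and V = "\<lambda>q. F q *\<^sub>R V q" and w = "\<lambda>r. f r * w r",
          OF I FV prod prod'] vec2_eq_iff F V I(2))
      (simp add: algebra_simps)
qed

section \<open>A solution of the Jacobi equation and the weight\<close>

text \<open>The variable \<open>s = ln (tan (r/2))\<close> satisfies \<open>ds/dr = 1 / sin r\<close>, and the powers of \<open>tan (r/2)\<close> are the
  exponentials in s.\<close>

lemma tan_half_powr_deriv:
  assumes "0 < r" "r < pi"
  shows "((\<lambda>r. tan (r / 2) powr a) has_real_derivative a * tan (r / 2) powr a / sin r) (at r)"
proof -
  have c: "cos (r / 2) > 0" and s: "sin (r / 2) > 0" 
    using assms by (auto intro: cos_gt_zero_pi sin_gt_zero)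
  then have t: "tan (r / 2) > 0" by (simp add: tan_def)
  have D: "((\<lambda>r. tan (r / 2)) has_real_derivative inverse ((cos (r / 2))\<^sup>2) * (1 / 2)) (at r)"
    using c by (intro DERIV_chain2[OF DERIV_tan]) (auto intro!: derivative_eq_intros)
  have "sin r = 2 * sin (r / 2) * cos (r / 2)"
    using sin_double[of "r / 2"] by simp
  then have "a * tan (r / 2) powr (a - of_nat 1) * (inverse ((cos (r / 2))\<^sup>2) * (1 / 2)) = a * tan (r / 2) powr a / sin r"
    using c s t by (simp add: powr_diff tan_def field_simps power2_eq_square)
  with DERIV_fun_powr[OF D t, of a] show ?thesis by simp
qed

text \<open>In the variable \<open>s = ln (tan (r/2))\<close>, where \<open>cos r = - tanh s\<close>, the radial Jacobi equation for
  \<open>k = sqrt 3\<close> becomes the Poeschl-Teller equation \<open>u'' = (3 - 6 sech\<^sup>2 s) u\<close>. Since \<open>6 = l (l + 1)\<close> with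
  \<open>l = 2\<close>, it has solutions \<open>exp (sqrt 3 s)\<close> times a quadratic polynomial in \<open>tanh s\<close>; the following is
  that solution in factorized form.\<close>

definition jacobi_profile :: "real \<Rightarrow> real" where
  "jacobi_profile r = tan (r / 2) powr sqrt 3 * (1 + sqrt 3 * cos r) * (2 + sqrt 3 * cos r)"

text \<open>With \<open>T = (tan (r/2))\<^bsup>sqrt 3\<^esup>\<close> and the quadratic factor \<open>q = 3 cos\<^sup>2 r + 3 sqrt 3 cos r + 2\<close>, the term
  \<open>3 q / sin\<^sup>2 r\<close> comes from the derivatives of T alone, and after division by T the remaining terms add up to \<open>- 6 q\<close>; that identity is what
  determines the coefficients of q. Then \<open>3 / sin\<^sup>2 r - 6 = 3 cos 2r / sin\<^sup>2 r\<close>.\<close>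

lemma jacobi_profile_ode:
  obtains u' u'' :: "real \<Rightarrow> real"
  where "\<And>r. 0 < r \<Longrightarrow> r < pi \<Longrightarrow> (jacobi_profile has_real_derivative u' r) (at r)"
    and "\<And>r. 0 < r \<Longrightarrow> r < pi \<Longrightarrow> (u' has_real_derivative u'' r) (at r)"
    and "\<And>r. 0 < r \<Longrightarrow> r < pi \<Longrightarrow>
      u'' r + cot r * u' r - 3 * cos (2 * r) / (sin r)\<^sup>2 * jacobi_profile r = 0"
proof
  define T where "T = (\<lambda>r. tan (r / 2) powr sqrt 3)"
  define q where "q = (\<lambda>r. 3 * (cos r)\<^sup>2 + 3 * sqrt 3 * cos r + 2)"
  define q' where "q' = (\<lambda>r. - (6 * cos r + 3 * sqrt 3) * sin r)"
  define q'' where "q'' = (\<lambda>r. 6 * (sin r)\<^sup>2 - (6 * cos r + 3 * sqrt 3) * cos r)"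
  define u' where "u' = (\<lambda>r. T r * (sqrt 3 * q r / sin r + q' r))"
  define u'' where "u'' = (\<lambda>r. T r * (3 * q r / (sin r)\<^sup>2 + 2 * sqrt 3 * q' r / sin r
    - sqrt 3 * q r * cos r / (sin r)\<^sup>2 + q'' r))"
  have u: "jacobi_profile = (\<lambda>r. T r * q r)"
    by (simp add: jacobi_profile_def T_def q_def fun_eq_iff algebra_simps power2_eq_square)
  have q: "(q has_real_derivative q' r) (at r)" for r
    unfolding q_def q'_def by (auto intro!: derivative_eq_intros simp: algebra_simps)
  have q': "(q' has_real_derivative q'' r) (at r)" for r
    unfolding q'_def q''_def by (auto intro!: derivative_eq_intros simp: algebra_simps power2_eq_square)
  fix r :: real assume r: "0 < r" "r < pi"
  then have s: "sin r > 0" by (rule sin_gt_zero)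
  have T: "(T has_real_derivative sqrt 3 * T r / sin r) (at r)"
    using tan_half_powr_deriv[OF r] by (simp add: T_def)
  have 33: "sqrt 3 * (sqrt 3 * x) = 3 * x" for x by (simp flip: mult.assoc)
  show "(jacobi_profile has_real_derivative u' r) (at r)"
    unfolding u u'_def by (auto intro!: derivative_eq_intros T q simp: algebra_simps)
  show "(u' has_real_derivative u'' r) (at r)"
    unfolding u'_def u''_def using s
    by (auto intro!: derivative_eq_intros T q q' simp: field_simps power2_eq_square 33)
  have "2 * sqrt 3 * q' r + sin r * q'' r + cos r * q' r
      = - 6 * sin r * q r + 6 * sin r * ((sin r)\<^sup>2 + (cos r)\<^sup>2 - 1)"
    by (simp add: q_def q'_def q''_def algebra_simps 33 power2_eq_square
        del: sin_cos_squared_add sin_cos_squared_add2 sin_cos_squared_add3)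
  then have "2 * sqrt 3 * q' r + sin r * q'' r + cos r * q' r = - 6 * sin r * q r"
    by simp
  then have "2 * sqrt 3 * q' r / sin r + q'' r + cot r * q' r = - 6 * q r"
    using s by (simp add: cot_def field_simps)
  moreover have "u'' r + cot r * u' r = T r * (3 * q r / (sin r)\<^sup>2 +
      (2 * sqrt 3 * q' r / sin r + q'' r + cot r * q' r))"
    using s by (simp add: u'_def u''_def cot_def field_simps power2_eq_square)
  ultimately have "u'' r + cot r * u' r = T r * (3 * q r / (sin r)\<^sup>2 - 6 * q r)" by simp
  then show "u'' r + cot r * u' r - 3 * cos (2 * r) / (sin r)\<^sup>2 * jacobi_profile r = 0"
    using s unfolding u cos_double_sin by (simp add: field_simps)
qed

text \<open>The half-angle substitution. The two linear factors of the profile in \<open>cos r\<close> become the two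
  factors of the weight in \<open>w = tan\<^sup>2 (r/2)\<close>, because \<open>(sqrt 3 + 1) / (sqrt 3 - 1) = 2 + sqrt 3\<close> and
  \<open>(2 + sqrt 3) / (2 - sqrt 3) = 7 + 4 sqrt 3\<close>.\<close>

lemma tan_half_identities:
  assumes "0 < r" "r < pi"
  defines "w \<equiv> (tan (r / 2))\<^sup>2"
  shows "tan (r / 2) > 0" "w > 0"
    "cos r = (1 - w) / (1 + w)" "sin r = 2 * tan (r / 2) / (1 + w)"
    "1 + sqrt 3 * cos r = - (sqrt 3 - 1) * (w - 2 - sqrt 3) / (1 + w)"
    "2 + sqrt 3 * cos r = (2 - sqrt 3) * (w + 7 + 4 * sqrt 3) / (1 + w)"
proof -
  have c: "cos (r / 2) > 0" and s: "sin (r / 2) > 0" 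
    using assms by (auto intro: cos_gt_zero_pi sin_gt_zero)
  then show t: "tan (r / 2) > 0" by (simp add: tan_def)
  then show w: "w > 0" by (simp add: w_def)
  show cos: "cos r = (1 - w) / (1 + w)"
    using cos_tan_half[of "r / 2"] c by (simp add: w_def)
  show "sin r = 2 * tan (r / 2) / (1 + w)"
    using sin_tan_half[of "r / 2"] by (simp add: w_def)
  show "1 + sqrt 3 * cos r = - (sqrt 3 - 1) * (w - 2 - sqrt 3) / (1 + w)"
    "2 + sqrt 3 * cos r = (2 - sqrt 3) * (w + 7 + 4 * sqrt 3) / (1 + w)"
    using w by (simp_all add: cos field_simps)
qed

text \<open>In terms of t = tan (r/2), \<open>tan r = 2 t / (1 - t\<^sup>2)\<close> accounts for the pole, and the profile for the
  rest. At \<open>r = pi/2\<close> both sides are 0, since the quotients with denominator 0 are.\<close>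

lemma weight_eq:
  assumes r: "0 < r" "r < pi"
  shows "\<bar>(tan (r/2) powr (1 + sqrt 3) * ((tan (r/2))\<^sup>2 + 7 + 4 * sqrt 3) * ((tan (r/2))\<^sup>2 - 2 - sqrt 3))
        / ((1 + (tan (r/2))\<^sup>2)\<^sup>2 * ((tan (r/2))\<^sup>2 - 1))\<bar>
     = (5 + 3 * sqrt 3) / 4 * \<bar>tan r * jacobi_profile r\<bar>"
proof -
  define t where "t = tan (r / 2)"
  define w where "w = t\<^sup>2"
  define T where "T = t powr sqrt 3"
  note b = tan_half_identities[OF r, folded t_def, folded w_def]
  have pow: "t powr (1 + sqrt 3) = t * T"
    using b(1) by (simp add: T_def powr_add)
  have tan: "tan r = 2 * t / (1 - w)"
    using b(2) by (simp add: tan_def b(3,4))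
  \<comment> \<open>The constant is the inverse of the one that the half-angle substitution produces.\<close>
  have const: "(5 + 3 * sqrt 3) / 4 * (2 * ((sqrt 3 - 1) * (2 - sqrt 3))) = 1"
    by (simp add: algebra_simps)
  have "tan r * jacobi_profile r
      = 2 * t / (1 - w) * (T * (- (sqrt 3 - 1) * (w - 2 - sqrt 3) / (1 + w)) * ((2 - sqrt 3) * (w + 7 + 4 * sqrt 3) / (1 + w)))"
    by (simp only: tan jacobi_profile_def b(5,6) T_def t_def)
  also have "\<dots> = (2 * ((sqrt 3 - 1) * (2 - sqrt 3))) *
      (t * T * (w + 7 + 4 * sqrt 3) * (w - 2 - sqrt 3) / ((1 + w)\<^sup>2 * (w - 1)))"
    using b(2) by (cases "w = 1") (simp_all add: power2_eq_square divide_simps, simp add: algebra_simps)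
  finally have "tan r * jacobi_profile r = \<dots>" .
  then have "(5 + 3 * sqrt 3) / 4 * (tan r * jacobi_profile r)
      = (5 + 3 * sqrt 3) / 4 * (2 * ((sqrt 3 - 1) * (2 - sqrt 3))) *
        (t * T * (w + 7 + 4 * sqrt 3) * (w - 2 - sqrt 3) / ((1 + w)\<^sup>2 * (w - 1)))"
    by (simp only: mult.assoc)
  then have "(5 + 3 * sqrt 3) / 4 * (tan r * jacobi_profile r)
      = t * T * (w + 7 + 4 * sqrt 3) * (w - 2 - sqrt 3) / ((1 + w)\<^sup>2 * (w - 1))"
    by (simp only: const mult_1)
  moreover have "(5 + 3 * sqrt 3) / 4 * \<bar>tan r * jacobi_profile r\<bar> = \<bar>(5 + 3 * sqrt 3) / 4 * (tan r * jacobi_profile r)\<bar>"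
    by (simp add: abs_mult)
  ultimately show ?thesis
    unfolding t_def[symmetric] w_def[symmetric] pow by simp
qed

lemma critical_radii:
  assumes "0 < r" "r < pi"
  shows "cos r = 0 \<longleftrightarrow> r = pi / 2"
    and "1 + sqrt 3 * cos r = 0 \<longleftrightarrow> r = 2 * arctan (sqrt (2 + sqrt 3))"
    and "2 + sqrt 3 * cos r > 0"
proof -
  show "cos r = 0 \<longleftrightarrow> r = pi / 2"
  proof
    show "cos r = 0 \<Longrightarrow> r = pi / 2"
      using cos_inj_pi[of r "pi / 2"] assms by simp
  qed (simp only: cos_pi_half)
  note b = tan_half_identities[OF assms]
  have "sqrt 3 > 1" "sqrt 3 < 2" by (simp_all add: real_less_lsqrt)
  show "2 + sqrt 3 * cos r > 0"
    unfolding b(6) using b(2) \<open>sqrt 3 < 2\<close> by (intro divide_pos_pos mult_pos_pos add_pos_pos) auto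
  have "1 + (tan (r / 2))\<^sup>2 \<noteq> 0" using b(2) by linarith
  then have "1 + sqrt 3 * cos r = 0 \<longleftrightarrow> (tan (r / 2))\<^sup>2 = 2 + sqrt 3"
    unfolding b(5) using \<open>sqrt 3 > 1\<close> by auto
  also have "\<dots> \<longleftrightarrow> tan (r / 2) = sqrt (2 + sqrt 3)"
    using b(1) by (auto simp: real_sqrt_unique)
  also have "\<dots> \<longleftrightarrow> r / 2 = arctan (sqrt (2 + sqrt 3))"
  proof
    assume "tan (r / 2) = sqrt (2 + sqrt 3)"
    then show "r / 2 = arctan (sqrt (2 + sqrt 3))"
      using arctan_unique[of "r / 2"] assms by simp
  qed (simp only: tan_arctan)
  finally show "1 + sqrt 3 * cos r = 0 \<longleftrightarrow> r = 2 * arctan (sqrt (2 + sqrt 3))" by auto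
qed

section \<open>Smoothness and singularities of the weight\<close>

text \<open>The weight f of the theorem on \<open>(0, pi)\<close>, as \<open>weight_eq\<close> shows.\<close>

definition weight :: "real \<Rightarrow> real" where
  "weight r = (5 + 3 * sqrt 3) / 4 * \<bar>tan r * jacobi_profile r\<bar>"

text \<open>The pole and the zero of the weight.\<close>

definition critical :: "real set" where
  "critical = {pi/2, 2 * arctan (sqrt (2 + sqrt 3))}"

lemma profile_nonzero:
  assumes "0 < r" "r < pi" "r \<notin> critical"
  shows "sin r > 0" "cos r \<noteq> 0" "tan r * jacobi_profile r \<noteq> 0"
proof -
  show s: "sin r > 0" using assms by (intro sin_gt_zero)
  show c: "cos r \<noteq> 0" using assms critical_radii(1)[of r] by (simp add: critical_def)
  have "1 + sqrt 3 * cos r \<noteq> 0" using assms critical_radii(2)[of r] by (simp add: critical_def)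
  moreover have "2 + sqrt 3 * cos r \<noteq> 0" using critical_radii(3)[of r] assms by simp
  moreover have "tan (r / 2) \<noteq> 0" using tan_half_identities(1)[of r] assms by simp
  moreover have "tan r \<noteq> 0" using s c by (simp add: tan_def)
  ultimately show "tan r * jacobi_profile r \<noteq> 0"
    by (simp add: jacobi_profile_def)
qed

abbreviation regular :: "real set" where
  "regular \<equiv> {0<..<pi} - critical"

lemma open_regular: "open regular"
  by (simp add: critical_def open_Diff finite_imp_closed)

lemma Ck_on_weight: "Ck_on n regular weight"
proof -
  note O = open_regular
  have half: "Ck_on n regular (\<lambda>r. r / 2)"
    by (rule Ck_on_linear[OF O bounded_linear_divide])
  have sc: "Ck_on n UNIV (sin :: real \<Rightarrow> real)" "Ck_on n UNIV (cos :: real \<Rightarrow> real)"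
    using Ck_on_sin_cos[of n] by auto
  have sin: "Ck_on n regular sin" and cos: "Ck_on n regular cos"
    using sc Ck_on_subset by blast+
  have inv: "Ck_on n regular (\<lambda>r. inverse (F r))" if "Ck_on n regular F" "\<And>r. r \<in> regular \<Longrightarrow> F r \<noteq> 0" for F :: "real \<Rightarrow> real"
    by (rule Ck_on_compose[OF O _ _ Ck_on_inverse that(1)]) (use that(2) in auto)
  have halfs: "Ck_on n regular (\<lambda>r. sin (r / 2))" "Ck_on n regular (\<lambda>r. cos (r / 2))"
    by (rule Ck_on_compose[OF O open_UNIV _ _ half]; simp add: sc)+
  have pos: "cos (r / 2) > 0" "sin (r / 2) > 0" if "r \<in> regular" for r
    using that by (auto intro: cos_gt_zero_pi sin_gt_zero)
  have tan: "Ck_on n regular (\<lambda>r. sin (r / 2) * inverse (cos (r / 2)))"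
    by (rule Ck_on_mult[OF O halfs(1) inv[OF halfs(2)]]) (use pos in force)
  have powr: "Ck_on n regular (\<lambda>r. (sin (r / 2) * inverse (cos (r / 2))) powr sqrt 3)"
    by (rule Ck_on_compose[OF O _ _ Ck_on_powr tan]) (use pos in auto)
  have aff: "Ck_on n regular (\<lambda>r. c + sqrt 3 * cos r)" for c
    by (rule Ck_on_add[OF O Ck_on_const[OF O] Ck_on_mult[OF O Ck_on_const[OF O] cos]])
  have "Ck_on n regular (\<lambda>r. (sin r * inverse (cos r)) *
      ((sin (r / 2) * inverse (cos (r / 2))) powr sqrt 3
        * (1 + sqrt 3 * cos r) * (2 + sqrt 3 * cos r)))" (is "Ck_on n _ ?G")
    using profile_nonzero(2)
    by (intro Ck_on_mult[OF O Ck_on_mult[OF O sin inv[OF cos]] Ck_on_mult[OF O Ck_on_mult[OF O powr aff] aff]]) simp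
  moreover have "?G r = tan r * jacobi_profile r" for r
    by (simp only: jacobi_profile_def tan_def divide_inverse[symmetric])
  ultimately have G: "Ck_on n regular (\<lambda>r. tan r * jacobi_profile r)" by simp
  have "Ck_on n regular (\<lambda>r. \<bar>tan r * jacobi_profile r\<bar>)"
    by (rule Ck_on_compose[OF O _ _ Ck_on_abs G]) (use profile_nonzero(3) in auto)
  then show ?thesis
    unfolding weight_def[abs_def] by (rule Ck_on_mult[OF O Ck_on_const[OF O]])
qed

lemma smooth_on_weight: "smooth_on regular weight"
  using Ck_on_weight open_regular by (simp add: smooth_on_def)

lemma jacobi_profile_pos_half_pi: "jacobi_profile (pi / 2) > 0"
proof -
  have "tan (pi / 2 / 2) > 0" using tan_half_identities(1)[of "pi / 2"] by simp
  then show ?thesis by (simp add: jacobi_profile_def)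
qed

lemma isCont_jacobi_profile:
  assumes "0 < r" "r < pi" shows "isCont jacobi_profile r"
  using jacobi_profile_ode assms by (metis DERIV_isCont)

text \<open>The profile does not vanish on the equator, so \<open>weight r * \<bar>cos r\<bar>\<close> has a positive limit there,
  whereas it would tend to 0 if the weight were continuous.\<close>

lemma weight_not_isCont_at_equator: "\<not> isCont weight (pi / 2)"
proof
  assume "isCont weight (pi / 2)"
  then have "((\<lambda>r. weight r * \<bar>cos r\<bar>) \<longlongrightarrow> weight (pi / 2) * \<bar>cos (pi / 2)\<bar>) (at (pi / 2))"
    by (intro tendsto_intros) (simp add: isCont_def)
  then have 1: "((\<lambda>r. weight r * \<bar>cos r\<bar>) \<longlongrightarrow> 0) (at (pi / 2))" by simp
  define G where "G = (\<lambda>r. (5 + 3 * sqrt 3) / 4 * \<bar>sin r * jacobi_profile r\<bar>)"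
  have "isCont G (pi / 2)"
    unfolding G_def by (intro continuous_intros isCont_jacobi_profile) auto
  then have 2: "(G \<longlongrightarrow> G (pi / 2)) (at (pi / 2))" by (simp add: isCont_def)
  have "eventually (\<lambda>r. r \<in> {0<..<pi}) (at (pi / 2))"
    by (rule eventually_at_in_open') auto
  moreover have "eventually (\<lambda>r. r \<noteq> pi / 2) (at (pi / 2))"
    by (simp add: eventually_at_filter)
  ultimately have "eventually (\<lambda>r. weight r * \<bar>cos r\<bar> = G r) (at (pi / 2))"
  proof eventually_elim
    case (elim r)
    then have "cos r \<noteq> 0" using critical_radii(1) by auto
    then show ?case by (simp add: weight_def G_def tan_def abs_mult)
  qed
  with 1 have "(G \<longlongrightarrow> 0) (at (pi / 2))" by (simp add: tendsto_cong)
  with 2 have "G (pi / 2) = 0" using tendsto_unique[of "at (pi / 2)"] by auto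
  then show False using jacobi_profile_pos_half_pi by (simp add: G_def) (smt (verit) real_sqrt_ge_zero)
qed

text \<open>If \<open>\<bar>B h\<bar>\<close> were differentiable at a zero of h, the derivative would be 0, as the zero is a minimum; but
  the absolute value of the difference quotient tends to \<open>\<bar>B x * h'\<bar>\<close>.\<close>

lemma not_differentiable_mult_abs:
  fixes B h :: "real \<Rightarrow> real"
  assumes "isCont B x" "B x \<noteq> 0" "(h has_real_derivative h') (at x)" "h x = 0" "h' \<noteq> 0"
  shows "\<not> (\<lambda>y. \<bar>B y * h y\<bar>) differentiable (at x)"
proof
  assume "(\<lambda>y. \<bar>B y * h y\<bar>) differentiable (at x)"
  then obtain D where D: "((\<lambda>y. \<bar>B y * h y\<bar>) has_real_derivative D) (at x)"
    by (auto simp: real_differentiable_def)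
  have "D = 0"
    by (rule DERIV_local_min[OF D zero_less_one]) (simp add: assms(4))
  with D have 1: "((\<lambda>y. \<bar>\<bar>B y * h y\<bar> / (y - x)\<bar>) \<longlongrightarrow> 0) (at x)"
    using tendsto_rabs_zero assms(4) by (fastforce simp: has_field_derivative_iff)
  have "((\<lambda>y. \<bar>B y * ((h y - h x) / (y - x))\<bar>) \<longlongrightarrow> \<bar>B x * h'\<bar>) (at x)"
    using assms(1,3) by (intro tendsto_intros) (auto simp: isCont_def has_field_derivative_iff)
  then have 2: "((\<lambda>y. \<bar>\<bar>B y * h y\<bar> / (y - x)\<bar>) \<longlongrightarrow> \<bar>B x * h'\<bar>) (at x)"
    by (simp add: assms(4) abs_mult)
  have "\<bar>B x * h'\<bar> = 0" using tendsto_unique[OF _ 2 1] by simp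
  then show False using assms by simp
qed

lemma weight_not_differentiable_at_zero:
  defines "r0 \<equiv> 2 * arctan (sqrt (2 + sqrt 3))"
  shows "\<not> weight differentiable (at r0)"
proof -
  have "0 < arctan (sqrt (2 + sqrt 3))" by (simp add: zero_less_arctan_iff add_pos_pos)
  then have r0: "0 < r0" "r0 < pi" using arctan_ubound[of "sqrt (2 + sqrt 3)"] by (simp_all add: r0_def)
  have h: "1 + sqrt 3 * cos r0 = 0" using critical_radii(2)[OF r0] by (simp add: r0_def)
  then have c: "cos r0 \<noteq> 0" by auto
  have s: "sin r0 > 0" using r0 by (rule sin_gt_zero)
  have t: "tan (r0 / 2) > 0" "cos (r0 / 2) \<noteq> 0"
    using tan_half_identities(1)[OF r0] by (auto simp: tan_def)
  define B where "B = (\<lambda>r. (5 + 3 * sqrt 3) / 4 * (tan r * tan (r / 2) powr sqrt 3 * (2 + sqrt 3 * cos r)))"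
  have "isCont B r0"
    unfolding B_def using c t by (intro continuous_intros) auto
  moreover have "5 + 3 * sqrt 3 \<noteq> 0" using real_sqrt_ge_zero[of 3] by linarith
  moreover have "tan r0 \<noteq> 0" using c s by (simp add: tan_def)
  ultimately have "isCont B r0" "B r0 \<noteq> 0"
    using t critical_radii(3)[OF r0] by (simp_all add: B_def)
  moreover have "((\<lambda>r. 1 + sqrt 3 * cos r) has_real_derivative - sqrt 3 * sin r0) (at r0)"
    by (auto intro!: derivative_eq_intros)
  ultimately have "\<not> (\<lambda>r. \<bar>B r * (1 + sqrt 3 * cos r)\<bar>) differentiable (at r0)"
    using h s by (intro not_differentiable_mult_abs[where h' = "- sqrt 3 * sin r0"]) auto
  moreover have "weight = (\<lambda>r. \<bar>B r * (1 + sqrt 3 * cos r)\<bar>)"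
    by (simp add: fun_eq_iff weight_def B_def jacobi_profile_def abs_mult)
  ultimately show ?thesis by simp
qed

lemma critical_subset: "critical \<subseteq> {0<..<pi}"
  using arctan_ubound[of "sqrt (2 + sqrt 3)"] by (auto simp: critical_def zero_less_arctan_iff add_pos_pos field_simps)

lemma not_smooth_at_weight_iff:
  assumes "0 < r" "r < pi"
  shows "\<not> smooth_at weight r \<longleftrightarrow> r \<in> critical"
proof
  show "r \<in> critical" if "\<not> smooth_at weight r"
    using that smooth_on_weight assms unfolding smooth_at_def by (metis DiffI greaterThanLessThan_iff)
  show "\<not> smooth_at weight r" if "r \<in> critical"
  proof -
    have "\<not> weight differentiable (at r)"
      using that weight_not_differentiable_at_zero weight_not_isCont_at_equator
        differentiable_imp_continuous_within[of weight "pi / 2" UNIV]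
      unfolding critical_def by blast
    then show ?thesis using smooth_at_imp_differentiable by blast
  qed
qed

section \<open>The f-biharmonic map\<close>

text \<open>By the Leibniz rule the expression is the Jacobi operator applied to \<open>F \<tau>\<close>. The radial component
  of \<open>\<tau>\<close> is \<open>(1 - 3) cot r\<close>, so the factor \<open>tan r\<close> of the weight cancels it, and \<open>F \<tau>\<close> is, up to a
  constant, the profile that solves the Jacobi equation. The constant depends on the sign of
  \<open>tan r * jacobi_profile r\<close>, which jumps at the critical radii only.\<close>

lemma f_biharmonic_equation:
  fixes p :: "real^2" and F :: "real^2 \<Rightarrow> real"
  assumes p: "p $ 1 \<in> regular" and F_weight: "\<And>q. q $ 1 \<in> regular \<Longrightarrow> F q = weight (q $ 1)"
  defines "\<phi> \<equiv> angular_dilation (sqrt 3)"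
  shows "F p *\<^sub>R bitension sphere_metric sphere_metric \<phi> p
      + laplacian sphere_metric F p *\<^sub>R tension sphere_metric sphere_metric \<phi> p
      + 2 *\<^sub>R pullback_conn sphere_metric \<phi> (gradient sphere_metric F)
          (tension sphere_metric sphere_metric \<phi>) p = 0"
proof -
  obtain u' u'' where
    u: "\<And>r. 0 < r \<Longrightarrow> r < pi \<Longrightarrow> (jacobi_profile has_real_derivative u' r) (at r)"
    and u': "\<And>r. 0 < r \<Longrightarrow> r < pi \<Longrightarrow> (u' has_real_derivative u'' r) (at r)"
    and ode: "\<And>r. 0 < r \<Longrightarrow> r < pi \<Longrightarrow>
      u'' r + cot r * u' r - 3 * cos (2 * r) / (sin r)\<^sup>2 * jacobi_profile r = 0"
    using jacobi_profile_ode by blast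
  define \<sigma> where "\<sigma> = sgn (tan (p $ 1) * jacobi_profile (p $ 1))"
  define \<kappa> where "\<kappa> = (5 + 3 * sqrt 3) / 4 * \<sigma>"
  \<comment> \<open>A neighbourhood of the given radius on which the sign is constant, so that the absolute value can
    be removed.\<close>
  define I where "I = regular \<inter> (\<lambda>r. \<sigma> * (tan r * jacobi_profile r)) -` {0<..}"
  have "continuous_on regular (\<lambda>r. \<sigma> * (tan r * jacobi_profile r))"
    using profile_nonzero(2) isCont_jacobi_profile
    by (intro continuous_at_imp_continuous_on ballI continuous_intros) auto
  then have I: "open I"
    unfolding I_def by (rule continuous_open_preimage[OF _ open_regular]) simp
  have nz: "tan (p $ 1) * jacobi_profile (p $ 1) \<noteq> 0"
    using profile_nonzero(3) p by auto
  then have pI: "p $ 1 \<in> I"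
    using p by (simp add: I_def \<sigma>_def sgn_mult_self_eq abs_sgn[symmetric] mult.commute[of "sgn _"])
  have s: "sin r \<noteq> 0" and c: "cos r \<noteq> 0" and r: "0 < r" "r < pi" if "r \<in> I" for r
    using that profile_nonzero(1,2)[of r] by (auto simp: I_def)
  have weight: "weight r = \<kappa> * (tan r * jacobi_profile r)" if "r \<in> I" for r
  proof -
    have "\<bar>\<sigma>\<bar> = 1" using nz by (simp add: \<sigma>_def abs_sgn_eq)
    then have "\<bar>tan r * jacobi_profile r\<bar> = \<bar>\<sigma> * (tan r * jacobi_profile r)\<bar>"
      by (simp add: abs_mult)
    also have "\<dots> = \<sigma> * (tan r * jacobi_profile r)"
      using that by (simp add: I_def)
    finally show ?thesis by (simp add: weight_def \<kappa>_def)
  qed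
  let ?\<tau> = "tension sphere_metric sphere_metric \<phi>"
  have \<tau>: "?\<tau> q = vector [- 2 * cot (q $ 1), 0]" if "q $ 1 \<in> I" for q
    using tension_angular_dilation[OF s[OF that], of "sqrt 3"] by (simp add: \<phi>_def)
  have cot: "((\<lambda>r. - 2 * cot r) has_real_derivative 2 * (1 + (cot r)\<^sup>2)) (at r)" if "r \<in> I" for r
  proof -
    have "(cot r)\<^sup>2 = inverse ((sin r)\<^sup>2) - 1"
      using s[OF that] cos_squared_eq[of r] by (simp add: cot_def power_divide field_simps)
    then show ?thesis
      using s[OF that] by (auto intro!: derivative_eq_intros DERIV_cot)
  qed
  have cot': "((\<lambda>r. 2 * (1 + (cot r)\<^sup>2)) has_real_derivative - 4 * cot r * inverse ((sin r)\<^sup>2)) (at r)"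
    if "r \<in> I" for r
    using s[OF that] by (auto intro!: derivative_eq_intros DERIV_cot)
  have tan: "(tan has_real_derivative 1 + (tan r)\<^sup>2) (at r)" if "r \<in> I" for r
    using DERIV_tan[OF c[OF that]] tan_sec[OF c[OF that]] by (simp add: power_inverse)
  define f where "f = (\<lambda>r. \<kappa> * (tan r * jacobi_profile r))"
  define f' where "f' = (\<lambda>r. \<kappa> * ((1 + (tan r)\<^sup>2) * jacobi_profile r + tan r * u' r))"
  have f: "(f has_real_derivative f' r) (at r)" if "r \<in> I" for r
    using DERIV_cmult[OF DERIV_mult[OF tan[OF that] u[OF r[OF that]]], of \<kappa>]
    by (simp add: f_def f'_def algebra_simps)
  have f': "(f' has_real_derivative \<kappa> * (2 * tan r * (1 + (tan r)\<^sup>2) * jacobi_profile r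
      + 2 * (1 + (tan r)\<^sup>2) * u' r + tan r * u'' r)) (at r)" if "r \<in> I" for r
  proof -
    have "((\<lambda>r. 1 + (tan r)\<^sup>2) has_real_derivative 2 * tan r * (1 + (tan r)\<^sup>2)) (at r)"
      using DERIV_add[OF DERIV_const DERIV_power[OF tan[OF that], of 2], of 1] by (simp add: ac_simps)
    from DERIV_cmult[OF DERIV_add[OF DERIV_mult[OF this u[OF r[OF that]]]
          DERIV_mult[OF tan[OF that] u'[OF r[OF that]]]], of \<kappa>]
    show ?thesis by (simp add: f'_def algebra_simps)
  qed
  have F: "F q = f (q $ 1)" if "q $ 1 \<in> I" for q
    using weight[OF that] F_weight[of q] that by (simp add: f_def I_def)
  have F\<tau>: "F q *\<^sub>R ?\<tau> q = vector [- 2 * \<kappa> * jacobi_profile (q $ 1), 0]" if "q $ 1 \<in> I" for q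
    using s[OF that] c[OF that] by (simp add: F \<tau> that vec2_eq_iff f_def cot_def tan_def)
  have w: "((\<lambda>r. - 2 * \<kappa> * jacobi_profile r) has_real_derivative - 2 * \<kappa> * u' r) (at r)"
    "((\<lambda>r. - 2 * \<kappa> * u' r) has_real_derivative - 2 * \<kappa> * u'' r) (at r)" if "r \<in> I" for r
    by (auto intro!: derivative_eq_intros u u' r that)
  have "F p *\<^sub>R bitension sphere_metric sphere_metric \<phi> p
      + laplacian sphere_metric F p *\<^sub>R ?\<tau> p
      + 2 *\<^sub>R pullback_conn sphere_metric \<phi> (gradient sphere_metric F) ?\<tau> p
    = jacobi_operator sphere_metric sphere_metric \<phi> (\<lambda>q. F q *\<^sub>R ?\<tau> q) p"
    unfolding bitension_eq_jacobi \<phi>_def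
    by (rule f_jacobi_radial[OF I pI s \<tau>[unfolded \<phi>_def] cot cot'[OF pI] F f f'[OF pI]])
  also have "\<dots> = vector [- 2 * \<kappa> * u'' (p $ 1) + cot (p $ 1) * (- 2 * \<kappa> * u' (p $ 1))
      - (sqrt 3)\<^sup>2 * cos (2 * p $ 1) / (sin (p $ 1))\<^sup>2 * (- 2 * \<kappa> * jacobi_profile (p $ 1)), 0]"
    unfolding \<phi>_def
    by (rule jacobi_operator_radial[OF I pI s F\<tau>[unfolded \<phi>_def] w(1) w(2)[OF pI]])
  also have "\<dots> = vector [- 2 * \<kappa> * (u'' (p $ 1) + cot (p $ 1) * u' (p $ 1)
      - 3 * cos (2 * p $ 1) / (sin (p $ 1))\<^sup>2 * jacobi_profile (p $ 1)), 0]"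
    by (simp add: vec2_eq_iff algebra_simps)
  also have "\<dots> = 0"
    unfolding ode[OF r[OF pI]] by (simp add: vec2_eq_iff)
  finally show ?thesis .
qed

theorem theorem3p4:
  fixes f :: "real \<Rightarrow> real" and \<phi> :: "real^2 \<Rightarrow> real^2" and P :: "real set"
  assumes "f = (\<lambda>r.
      \<bar>(tan (r/2) powr (1 + sqrt 3) * ((tan (r/2))\<^sup>2 + 7 + 4 * sqrt 3) * ((tan (r/2))\<^sup>2 - 2 - sqrt 3))
        / ((1 + (tan (r/2))\<^sup>2)\<^sup>2 * ((tan (r/2))\<^sup>2 - 1))\<bar>)"
    and "\<phi> = (\<lambda>x. vector [x $ 1, sqrt 3 * x $ 2])"
    and "P = {pi/2, 2 * arctan (sqrt (2 + sqrt 3))}"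
  shows "f_biharmonic {x \<in> polar_domain. x $ 1 \<notin> P} sphere_metric polar_domain sphere_metric
           (\<lambda>x. f (x $ 1)) \<phi>
       \<and> {r \<in> {0<..<pi}. \<not> smooth_at f r} = P"
proof
  define U where "U = {x \<in> polar_domain. x $ 1 \<notin> P}"
  have P: "P = critical" and \<phi>: "\<phi> = angular_dilation (sqrt 3)"
    using assms(2,3) by (simp_all add: critical_def angular_dilation_def[abs_def])
  \<comment> \<open>The half-angle substitution is valid on the interval. It is open, so agreement there is enough
    to compare smoothness and derivatives.\<close>
  have f: "f r = weight r" if "r \<in> {0<..<pi}" for r
    using weight_eq that by (simp add: assms(1) weight_def)
  have U: "U = {x. x $ 1 \<in> regular}"
    by (auto simp: U_def polar_domain_def P)
  have oU: "open U"
    unfolding U by (rule open_radial[OF open_regular])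
  have polar: "open polar_domain"
    using open_radial[of "{0<..<pi}"] by (simp add: polar_domain_def)
  show "f_biharmonic {x \<in> polar_domain. x $ 1 \<notin> P} sphere_metric polar_domain sphere_metric
      (\<lambda>x. f (x $ 1)) \<phi>"
    unfolding f_biharmonic_def U_def[symmetric]
  proof (intro conjI ballI)
    show "riemannian_metric_on U sphere_metric" "riemannian_metric_on polar_domain sphere_metric"
      using riemannian_metric_on_sphere oU polar by (auto simp: U_def)
    show "smooth_on U \<phi>"
      using oU Ck_on_linear[OF oU bounded_linear_angular_dilation] by (simp add: smooth_on_def \<phi>)
    show "\<phi> ` U \<subseteq> polar_domain"
      by (auto simp: \<phi> U_def polar_domain_def angular_dilation_def)
    have w: "f (x $ 1) = weight (x $ 1)" if "x \<in> U" for x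
      using that f by (simp add: U)
    have "Ck_on n U (\<lambda>x. weight (x $ 1))" for n
      by (rule Ck_on_compose[OF oU open_regular _ Ck_on_weight Ck_on_linear[OF oU bounded_linear_vec_nth]])
        (auto simp: U)
    then have "Ck_on n U (\<lambda>x. f (x $ 1))" for n
      by (rule Ck_on_cong[OF oU, rotated]) (simp add: w)
    then show "smooth_on U (\<lambda>x. f (x $ 1))"
      using oU by (simp add: smooth_on_def)
    fix x assume x: "x \<in> U"
    show "f (x $ 1) > 0"
    proof -
      have "5 + 3 * sqrt 3 > 0" using real_sqrt_ge_zero[of 3] by linarith
      then show ?thesis
        unfolding w[OF x] weight_def using x profile_nonzero(3)[of "x $ 1"]
        by (intro mult_pos_pos) (auto simp: U)
    qed
    show "f (x $ 1) *\<^sub>R bitension sphere_metric sphere_metric \<phi> x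
        + laplacian sphere_metric (\<lambda>x. f (x $ 1)) x *\<^sub>R tension sphere_metric sphere_metric \<phi> x
        + 2 *\<^sub>R pullback_conn sphere_metric \<phi> (gradient sphere_metric (\<lambda>x. f (x $ 1)))
            (tension sphere_metric sphere_metric \<phi>) x = 0"
      unfolding \<phi> by (rule f_biharmonic_equation) (use x f in \<open>auto simp: U\<close>)
  qed
  show "{r \<in> {0<..<pi}. \<not> smooth_at f r} = P"
  proof -
    have "smooth_at f r \<longleftrightarrow> smooth_at weight r" if "r \<in> {0<..<pi}" for r
      by (rule smooth_at_cong[of "{0<..<pi}"]) (use that f in auto)
    then have "{r \<in> {0<..<pi}. \<not> smooth_at f r} = {r \<in> {0<..<pi}. r \<in> critical}"
      using not_smooth_at_weight_iff by auto
    then show ?thesis using critical_subset P by blast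
  qed
qed

end
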